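(* Let $(M,\mathscr{L})$ be a pseudo-Finsler space modeled on a pseudo-Minkowski space $(V,L)$, with local vierbein $e^a_\mu(x)$ and commutation coefficients $c^a{}_{bc}(x)$. Then the Berwald curvature, in vierbein components, is given by $$2G^r_{abc}=2G^\rho_{\alpha\beta\gamma}e^r_\rho e^\alpha_ae^\beta_be^\gamma_c=c^e{}_{mn}\,\frac{\partial^3}{\partial y^a\partial y^b\partial y^c}\big(g^{rm}y_e y^n\big),$$ and the mean Berwald curvature $E_{bc}:=\frac12G^r_{rbc}$ follows from $$G^r_{rbc}=-c^e{}_{mn}\,\frac{\partial^2}{\partial y^b\partial y^c}\big(I^m y_e y^n\big).$$
   Context: Einstein's summation convention is used. A pseudo-Minkowski space is a pair $(V,L)$ where $V$ is a finite-dimensional real vector space and $L\colon\bar\omega\to\mathbb{R}$ is defined on the closure of an open cone $\omega\subset V$ with vertex the origin, with $L\in C^4(\omega)\cap C^0(\bar\omega)$, $L(sy)=s^2L(y)$ for $s>0$, and non-degenerate Hessian on $\omega$. A pseudo-Finsler space is a pair $(M,\mathscr{L})$, $\dim M=\dim V$, $\mathscr{L}\colon\bar\Omega\to\mathbb{R}$, $\Omega\subset TM$ projecting onto $M$, such that each $(T_xM,\mathscr{L}_x)$, with $\mathscr{L}_x$ the restriction of $\mathscr{L}$ to the fibre (cone $\Omega_x=\Omega\cap T_xM$), is a pseudo-Minkowski space with signature independent of $x$; the dependence of $\mathscr{L}$ on $x$ is $C^2$. It is modeled on $(V,L)$ if locally, for $x\in U\subset M$, there are linear isomorphisms $\varphi_x\colon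 T_xM\to V$, sufficiently differentiable in $x$, with $\varphi_x(\Omega_x)=\omega$ and $L(\varphi_x(y))=\mathscr{L}_x(y)$ for every $y\in\bar\Omega_x$. Fix a basis $\{\tilde e_a\}$ of $V$ and put $e_a=\varphi_x^{-1}(\tilde e_a)=e^\mu_a\partial_\mu$, with dual basis $e^a=e^a_\mu dx^\mu$ (the vierbein), in local coordinates $x^\mu$ of $M$. A tangent vector is $y=y^\mu\partial_\mu=y^ae_a$, $y^\mu=y^ae^\mu_a$; regarding $L$ as a function of $(y^a)$, $\mathscr{L}(x^\mu,y^\nu)=L(e^a_\nu(x)y^\nu)$. The commutation coefficients are defined by $[e_a,e_b]=c^c{}_{ab}e_c$. With $\partial_a=\partial/\partial y^a$: $y_a=\partial_aL$, $g_{ab}=\partial_a\partial_bL$, $g^{ab}$ the inverse of $g_{ab}$, $C_{abc}=\frac12\partial_a\partial_b\partial_cL$, $I_a=g^{bc}C_{abc}$, $I^a=g^{ab}I_b$. These depend only on $(y^a)$. With $g_{\mu\nu}=\partial^2\mathscr{L}/\partial y^\mu\partial y^\nu$ and inverse $g^{\mu\nu}$, the spray is $G^\mu:=\frac12g^{\mu\sigma}\big(\frac{\partial^2\mathscr{L}}{\partial x^\rho\partial y^\sigma}y^\rho-\frac{\partial\mathscr{L}}{\partial x^\sigma}\big)$. The Berwald curvature is $G^\rho_{\alpha\beta\gamma}:=\frac{\partial^3G^\rho}{\partial y^\alpha\partial y^\beta\partial y^\gamma}$.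
   Formalization: L is additionally assumed to have differentiable fourth partial derivatives at the point y^a considered (automatic for C^5), since the formulas contain fifth derivatives of L, which need not exist for L only C^4. *)

theory Defs
  imports "HOL-Analysis.Analysis"
begin

section \<open>Differentiability and partial derivatives\<close>

text \<open>Class \<open>C\<^sup>k\<close> on an open set of a finite-dimensional space: all iterated directional
  derivatives up to order \<open>k\<close> exist and are continuous.\<close>

primrec C_on :: "nat \<Rightarrow> ('a::real_normed_vector \<Rightarrow> 'b::real_normed_vector) \<Rightarrow> 'a set \<Rightarrow> bool" where
  "C_on 0 f S \<longleftrightarrow> continuous_on S f"
| "C_on (Suc k) f S \<longleftrightarrow>
     (\<forall>x\<in>S. f differentiable (at x)) \<and>
     (\<forall>v. C_on k (\<lambda>x. frechet_derivative f (at x) v) S)"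

definition partial :: "'n \<Rightarrow> (real^'n::finite \<Rightarrow> real) \<Rightarrow> real^'n \<Rightarrow> real" where
  "partial i f y = deriv (\<lambda>t. f (y + t *\<^sub>R axis i 1)) 0"

definition hessian :: "('v::euclidean_space \<Rightarrow> real) \<Rightarrow> 'v \<Rightarrow> 'v \<Rightarrow> 'v \<Rightarrow> real" where
  "hessian f y u v = frechet_derivative (\<lambda>z. frechet_derivative f (at z) v) (at y) u"

definition pos_index :: "('v::euclidean_space \<Rightarrow> 'v \<Rightarrow> real) \<Rightarrow> nat" where
  "pos_index B = Max {dim S | S. subspace S \<and> (\<forall>v\<in>S. v \<noteq> 0 \<longrightarrow> B v v > 0)}"

definition signature :: "('v::euclidean_space \<Rightarrow> 'v \<Rightarrow> real) \<Rightarrow> nat \<times> nat" where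
  "signature B = (pos_index B, pos_index (\<lambda>u v. - B u v))"


section \<open>Pseudo-Minkowski spaces\<close>

text \<open>The library's \<^const>\<open>cone\<close> forces the vertex to belong to the set, which
  an open cone need not satisfy. The value of \<open>L\<close> outside \<open>closure \<omega>\<close> is irrelevant.\<close>

definition open_cone :: "'v::euclidean_space set \<Rightarrow> bool" where
  "open_cone \<omega> \<longleftrightarrow> open \<omega> \<and> \<omega> \<noteq> {} \<and> (\<forall>y\<in>\<omega>. \<forall>s>0. s *\<^sub>R y \<in> \<omega>)"

definition pseudo_minkowski :: "'v::euclidean_space set \<Rightarrow> ('v \<Rightarrow> real) \<Rightarrow> bool" where
  "pseudo_minkowski \<omega> L \<longleftrightarrow>
     open_cone \<omega> \<and>
     C_on 4 L \<omega> \<and> continuous_on (closure \<omega>) L \<and>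
     (\<forall>y\<in>closure \<omega>. \<forall>s>0. L (s *\<^sub>R y) = s\<^sup>2 * L y) \<and>
     (\<forall>y\<in>\<omega>. \<forall>u. (\<forall>v. hessian L y u v = 0) \<longrightarrow> u = 0)"


section \<open>Manifolds and tangent spaces\<close>

text \<open>The manifold is the whole type \<open>'m\<close>, with a topology and an atlas. A chart is
  an open set together with a coordinate map, whose values off that set are irrelevant.\<close>

type_synonym ('m, 'n) chart = "'m set \<times> ('m \<Rightarrow> real^'n)"

definition chart_pt :: "('m, 'n) chart \<Rightarrow> real^'n::finite \<Rightarrow> 'm" where
  "chart_pt ch = inv_into (fst ch) (snd ch)"

definition transition :: "('m, 'n) chart \<Rightarrow> ('m, 'n) chart \<Rightarrow> real^'n::finite \<Rightarrow> real^'n" where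
  "transition ch ch' = snd ch' \<circ> chart_pt ch"

text \<open>Coordinate changes are only asked to be \<open>C\<^sup>3\<close>, so that the tangent bundle is of class
  \<open>C\<^sup>2\<close>; every smooth manifold is included.\<close>

definition manifold_atlas ::
    "('m::{t2_space, second_countable_topology}, 'n::finite) chart set \<Rightarrow> bool" where
  "manifold_atlas A \<longleftrightarrow>
     (\<Union>ch\<in>A. fst ch) = UNIV \<and>
     (\<forall>ch\<in>A. open (fst ch) \<and> open (snd ch ` fst ch) \<and>
        homeomorphism (fst ch) (snd ch ` fst ch) (snd ch) (chart_pt ch)) \<and>
     (\<forall>ch\<in>A. \<forall>ch'\<in>A. C_on 3 (transition ch ch') (snd ch ` (fst ch \<inter> fst ch')))"

text \<open>A tangent vector at \<open>p\<close> is the family \<open>(y\<^sup>\<mu>)\<close> of its components in all charts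
  around \<open>p\<close>, related by the Jacobians of the coordinate changes. Charts that do not
  contain \<open>p\<close> get the dummy value 0.\<close>

type_synonym ('m, 'n) tvec = "('m, 'n) chart \<Rightarrow> real^'n"

definition tangent_space ::
    "('m, 'n::finite) chart set \<Rightarrow> 'm \<Rightarrow> ('m, 'n) tvec set" where
  "tangent_space A p = {v.
     (\<forall>ch. \<not> (ch \<in> A \<and> p \<in> fst ch) \<longrightarrow> v ch = 0) \<and>
     (\<forall>ch\<in>A. \<forall>ch'\<in>A. p \<in> fst ch \<and> p \<in> fst ch' \<longrightarrow>
        v ch' = frechet_derivative (transition ch ch') (at (snd ch p)) (v ch))}"

text \<open>The tangent vector \<open>y\<^sup>\<mu>\<partial>\<^sub>\<mu>\<close> at \<open>p\<close>.\<close>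

definition tangent_of ::
    "('m, 'n::finite) chart set \<Rightarrow> ('m, 'n) chart \<Rightarrow> 'm \<Rightarrow> real^'n \<Rightarrow> ('m, 'n) tvec" where
  "tangent_of A ch p y = (THE v. v \<in> tangent_space A p \<and> v ch = y)"


section \<open>Pseudo-Finsler spaces\<close>

text \<open>\<open>\<Omega> p\<close> is the fibre \<open>\<Omega> \<inter> T\<^sub>pM\<close> and \<open>\<L> p\<close> is the restriction of the
  Lagrangian to that fibre.\<close>

definition fibre_cone :: "('m \<Rightarrow> ('m, 'n::finite) tvec set) \<Rightarrow> ('m, 'n) chart \<Rightarrow> 'm \<Rightarrow> (real^'n) set" where
  "fibre_cone \<Omega> ch p = (\<lambda>v. v ch) ` \<Omega> p"

text \<open>The coordinate expression \<open>\<L>(x\<^sup>\<mu>, y\<^sup>\<nu>)\<close>.\<close>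

definition coord_lagrangian ::
    "('m, 'n::finite) chart set \<Rightarrow> ('m \<Rightarrow> ('m, 'n) tvec \<Rightarrow> real) \<Rightarrow> ('m, 'n) chart
      \<Rightarrow> real^'n \<Rightarrow> real^'n \<Rightarrow> real" where
  "coord_lagrangian A \<L> ch x y = \<L> (chart_pt ch x) (tangent_of A ch (chart_pt ch x) y)"

text \<open>The pseudo-Minkowski property is invariant under linear isomorphisms, so it is stated
  on the components. Cones are not assumed connected, hence what is independent of the
  point is the set of signatures attained by the Hessian on the fibre (a single one for
  connected cones). The \<open>C\<^sup>2\<close> dependence on \<open>x\<close> is at fixed \<open>y\<^sup>\<mu>\<close>, where defined.\<close>

definition pseudo_finsler ::
    "('m::{t2_space, second_countable_topology}, 'n::finite) chart set \<Rightarrow>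
     ('m \<Rightarrow> ('m, 'n) tvec set) \<Rightarrow> ('m \<Rightarrow> ('m, 'n) tvec \<Rightarrow> real) \<Rightarrow> bool" where
  "pseudo_finsler A \<Omega> \<L> \<longleftrightarrow>
     manifold_atlas A \<and>
     (\<forall>p. \<Omega> p \<subseteq> tangent_space A p \<and> \<Omega> p \<noteq> {}) \<and>
     (\<forall>ch\<in>A. \<forall>p\<in>fst ch. pseudo_minkowski (fibre_cone \<Omega> ch p) (\<lambda>y. \<L> p (tangent_of A ch p y))) \<and>
     (\<exists>\<Sigma>. \<forall>ch\<in>A. \<forall>p\<in>fst ch.
        (\<lambda>y. signature (hessian (\<lambda>z. \<L> p (tangent_of A ch p z)) y)) ` fibre_cone \<Omega> ch p = \<Sigma>) \<and>
     (\<forall>ch\<in>A. \<forall>y W. open W \<and> W \<subseteq> {x \<in> snd ch ` fst ch. y \<in> fibre_cone \<Omega> ch (chart_pt ch x)} \<longrightarrow>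
        C_on 2 (\<lambda>x. coord_lagrangian A \<L> ch x y) W)"

text \<open>Linearity of \<open>\<phi> p\<close> is spelled out because the functions on charts do not form
  an instance of \<^class>\<open>real_vector\<close>. The closure of \<open>\<Omega> p\<close> is taken in the product topology,
  which induces on the tangent space its usual topology.
  \<open>C\<^sup>1\<close> dependence on the point is what the commutation coefficients require.\<close>

definition local_model ::
    "('m::{t2_space, second_countable_topology}, 'n::finite) chart set \<Rightarrow>
     ('m \<Rightarrow> ('m, 'n) tvec set) \<Rightarrow> ('m \<Rightarrow> ('m, 'n) tvec \<Rightarrow> real) \<Rightarrow>
     'v::euclidean_space set \<Rightarrow> ('v \<Rightarrow> real) \<Rightarrow> 'm set \<Rightarrow> ('m \<Rightarrow> ('m, 'n) tvec \<Rightarrow> 'v) \<Rightarrow> bool" where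
  "local_model A \<Omega> \<L> \<omega> L U \<phi> \<longleftrightarrow>
     open U \<and>
     (\<forall>p\<in>U.
        bij_betw (\<phi> p) (tangent_space A p) UNIV \<and>
        (\<forall>u\<in>tangent_space A p. \<forall>v\<in>tangent_space A p. \<forall>s t.
           \<phi> p (\<lambda>ch. s *\<^sub>R u ch + t *\<^sub>R v ch) = s *\<^sub>R \<phi> p u + t *\<^sub>R \<phi> p v) \<and>
        \<phi> p ` \<Omega> p = \<omega> \<and>
        (\<forall>v\<in>closure (\<Omega> p). L (\<phi> p v) = \<L> p v)) \<and>
     (\<forall>ch\<in>A. \<forall>y. C_on 1 (\<lambda>x. \<phi> (chart_pt ch x) (tangent_of A ch (chart_pt ch x) y))
        (snd ch ` (U \<inter> fst ch)))"

definition modeled_on ::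
    "('m::{t2_space, second_countable_topology}, 'n::finite) chart set \<Rightarrow>
     ('m \<Rightarrow> ('m, 'n) tvec set) \<Rightarrow> ('m \<Rightarrow> ('m, 'n) tvec \<Rightarrow> real) \<Rightarrow>
     'v::euclidean_space set \<Rightarrow> ('v \<Rightarrow> real) \<Rightarrow> bool" where
  "modeled_on A \<Omega> \<L> \<omega> L \<longleftrightarrow>
     CARD('n) = DIM('v) \<and> (\<forall>p. \<exists>U \<phi>. p \<in> U \<and> local_model A \<Omega> \<L> \<omega> L U \<phi>)"


section \<open>Vierbein and commutation coefficients\<close>

definition is_basis :: "('n::finite \<Rightarrow> 'v::euclidean_space) \<Rightarrow> bool" where
  "is_basis b \<longleftrightarrow> inj b \<and> independent (range b) \<and> span (range b) = UNIV"

text \<open>\<open>vierbein A ch \<phi> b a x $ \<mu>\<close> is \<open>e\<^sup>\<mu>\<^sub>a(x)\<close>, where \<open>e\<^sub>a = \<phi>\<^sub>x\<^sup>-\<^sup>1(b a)\<close>.\<close>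

definition vierbein ::
    "('m, 'n::finite) chart set \<Rightarrow> ('m, 'n) chart \<Rightarrow> ('m \<Rightarrow> ('m, 'n) tvec \<Rightarrow> 'v) \<Rightarrow>
     ('n \<Rightarrow> 'v) \<Rightarrow> 'n \<Rightarrow> real^'n \<Rightarrow> real^'n" where
  "vierbein A ch \<phi> b a x =
     inv_into (tangent_space A (chart_pt ch x)) (\<phi> (chart_pt ch x)) (b a) ch"

text \<open>The dual basis: \<open>dual_vierbein e x $ a $ \<mu>\<close> is \<open>e\<^sup>a\<^sub>\<mu>(x)\<close>.\<close>

definition dual_vierbein :: "('n::finite \<Rightarrow> real^'n \<Rightarrow> real^'n) \<Rightarrow> real^'n \<Rightarrow> real^'n^'n" where
  "dual_vierbein e x = matrix_inv (\<chi> \<mu> a. e a x $ \<mu>)"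

definition lie_bracket ::
    "(real^'n::finite \<Rightarrow> real^'n) \<Rightarrow> (real^'n \<Rightarrow> real^'n) \<Rightarrow> real^'n \<Rightarrow> real^'n" where
  "lie_bracket X Y x = (\<chi> \<mu>. \<Sum>\<nu>\<in>UNIV.
     X x $ \<nu> * partial \<nu> (\<lambda>z. Y z $ \<mu>) x - Y x $ \<nu> * partial \<nu> (\<lambda>z. X z $ \<mu>) x)"

text \<open>\<open>c x k i j\<close> is \<open>c\<^sup>k\<^sub>i\<^sub>j(x)\<close>.\<close>

definition commutation_coeffs ::
    "('n::finite \<Rightarrow> real^'n \<Rightarrow> real^'n) \<Rightarrow> (real^'n) set \<Rightarrow>
     (real^'n \<Rightarrow> 'n \<Rightarrow> 'n \<Rightarrow> 'n \<Rightarrow> real) \<Rightarrow> bool" where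
  "commutation_coeffs e S c \<longleftrightarrow>
     (\<forall>x\<in>S. \<forall>i j. lie_bracket (e i) (e j) x = (\<Sum>k\<in>UNIV. c x k i j *\<^sub>R e k x))"


section \<open>Tensors of a Lagrangian on the fibre\<close>

text \<open>\<open>L\<close> as a function of the components \<open>(y\<^sup>a)\<close> with respect to a basis of \<open>V\<close>.\<close>

definition in_basis :: "('n::finite \<Rightarrow> 'v::euclidean_space) \<Rightarrow> ('v \<Rightarrow> real) \<Rightarrow> real^'n \<Rightarrow> real" where
  "in_basis b L y = L (\<Sum>a\<in>UNIV. y $ a *\<^sub>R b a)"

definition metric :: "(real^'n::finite \<Rightarrow> real) \<Rightarrow> real^'n \<Rightarrow> real^'n^'n" where
  "metric f y = (\<chi> a b. partial a (partial b f) y)"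

definition inv_metric :: "(real^'n::finite \<Rightarrow> real) \<Rightarrow> real^'n \<Rightarrow> real^'n^'n" where
  "inv_metric f y = matrix_inv (metric f y)"

definition cartan :: "(real^'n::finite \<Rightarrow> real) \<Rightarrow> 'n \<Rightarrow> 'n \<Rightarrow> 'n \<Rightarrow> real^'n \<Rightarrow> real" where
  "cartan f a b c y = 1/2 * partial a (partial b (partial c f)) y"

definition mean_cartan_low :: "(real^'n::finite \<Rightarrow> real) \<Rightarrow> 'n \<Rightarrow> real^'n \<Rightarrow> real" where
  "mean_cartan_low f a y = (\<Sum>b\<in>UNIV. \<Sum>c\<in>UNIV. inv_metric f y $ b $ c * cartan f a b c y)"

definition mean_cartan :: "(real^'n::finite \<Rightarrow> real) \<Rightarrow> 'n \<Rightarrow> real^'n \<Rightarrow> real" where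
  "mean_cartan f a y = (\<Sum>b\<in>UNIV. inv_metric f y $ a $ b * mean_cartan_low f b y)"


section \<open>Spray and Berwald curvature\<close>

text \<open>Here \<open>F x y\<close> is a Lagrangian in local coordinates.\<close>

definition spray :: "(real^'n::finite \<Rightarrow> real^'n \<Rightarrow> real) \<Rightarrow> real^'n \<Rightarrow> 'n \<Rightarrow> real^'n \<Rightarrow> real" where
  "spray F x \<mu> y = 1/2 * (\<Sum>\<sigma>\<in>UNIV. inv_metric (F x) y $ \<mu> $ \<sigma> *
     ((\<Sum>\<rho>\<in>UNIV. partial \<rho> (\<lambda>z. partial \<sigma> (F z) y) x * y $ \<rho>) - partial \<sigma> (\<lambda>z. F z y) x))"

definition berwald ::
    "(real^'n::finite \<Rightarrow> real^'n \<Rightarrow> real) \<Rightarrow> real^'n \<Rightarrow> real^'n \<Rightarrow> 'n \<Rightarrow> 'n \<Rightarrow> 'n \<Rightarrow> 'n \<Rightarrow> real" where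
  "berwald F x y \<rho> \<alpha> \<beta> \<gamma> = partial \<alpha> (partial \<beta> (partial \<gamma> (spray F x \<rho>))) y"

text \<open>The vierbein components \<open>G\<^sup>r\<^sub>a\<^sub>b\<^sub>c\<close>.\<close>

definition berwald_frame ::
    "(real^'n::finite \<Rightarrow> real^'n \<Rightarrow> real) \<Rightarrow> ('n \<Rightarrow> real^'n \<Rightarrow> real^'n) \<Rightarrow> real^'n \<Rightarrow> real^'n
      \<Rightarrow> 'n \<Rightarrow> 'n \<Rightarrow> 'n \<Rightarrow> 'n \<Rightarrow> real" where
  "berwald_frame F e x y r a b c = (\<Sum>\<rho>\<in>UNIV. \<Sum>\<alpha>\<in>UNIV. \<Sum>\<beta>\<in>UNIV. \<Sum>\<gamma>\<in>UNIV.
     berwald F x y \<rho> \<alpha> \<beta> \<gamma> * dual_vierbein e x $ r $ \<rho> * e a x $ \<alpha> * e b x $ \<beta> * e c x $ \<gamma>)"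

definition mean_berwald ::
    "(real^'n::finite \<Rightarrow> real^'n \<Rightarrow> real) \<Rightarrow> ('n \<Rightarrow> real^'n \<Rightarrow> real^'n) \<Rightarrow> real^'n \<Rightarrow> real^'n
      \<Rightarrow> 'n \<Rightarrow> 'n \<Rightarrow> real" where
  "mean_berwald F e x y b c = 1/2 * (\<Sum>r\<in>UNIV. berwald_frame F e x y r r b c)"

end

theory Submission
  imports Defs
begin

text \<open>In the frame, \<open>\<L>(x, y) = L(e\<^sup>a\<^sub>\<nu>(x) y\<^sup>\<nu>)\<close>, so every \<open>x\<close>-derivative of \<open>\<L>\<close> falls on the dual vierbein.
  The symmetric part of \<open>\<partial>\<^sub>\<rho>e\<^sup>a\<^sub>\<nu>\<close> contributes to the spray a term quadratic in \<open>y\<close>, the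
  antisymmetric part is \<open>de\<^sup>a\<close>, that is, the commutation coefficients:
  \<open>2G\<^sup>\<mu> = e\<^sup>\<mu>\<^sub>r (quadratic\<^sup>r(y) + c\<^sup>i\<^sub>m\<^sub>n g\<^sup>r\<^sup>m y\<^sub>i y\<^sup>n)\<close>. Three vertical derivatives kill the quadratic term.
  For the trace one commutes \<open>\<partial>\<^sub>r\<close> to the inside and uses \<open>\<partial>\<^sub>rg\<^sup>r\<^sup>m = - 2I\<^sup>m\<close>.\<close>

section \<open>Iterated partial derivatives\<close>

text \<open>Regularity shapes the proof. The right-hand sides differentiate the inverse metric,
  built from second derivatives of \<open>f\<close>, three times, and I^m, built from third
  derivatives, twice. Both reach order five, while \<open>L\<close> is only C^4 on the cone; the
  fifth order comes from differentiability of the fourth partials at the single point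
  \<open>w\<close>. Hence the calculus is pointwise: an identity is kept on a neighbourhood as long
  as it has to be differentiated again, and may drop to the point only at the last derivative. The
  frame is carried by the dual vierbein \<open>B\<close>, because the e^a_\<mu> are the components
  of \<phi>(\<partial>_\<mu>), whose differentiability in x is what \<open>local_model\<close>
  provides; e^\<mu>_a is then reached as an inverse matrix. The rule d(B^-1) = - B^-1 dB B^-1 links
  the Lie bracket of the e_a to the antisymmetrised \<open>dB\<close>.\<close>

lemma partial_has_derivative:
  fixes f :: "real^'n \<Rightarrow> real"
  assumes "(f has_derivative D) (at y)"
  shows "partial i f y = D (axis i 1)"
proof -
  have lin: "linear D"
    using assms has_derivative_linear by blast
  have "((\<lambda>t::real. y + t *\<^sub>R axis i 1) has_derivative (\<lambda>t. t *\<^sub>R axis i 1)) (at 0)"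
    by (auto intro!: derivative_eq_intros)
  moreover have "(f has_derivative D) (at (y + 0 *\<^sub>R axis i 1))"
    using assms by simp
  ultimately have "((\<lambda>t::real. f (y + t *\<^sub>R axis i 1)) has_derivative (\<lambda>t. D (t *\<^sub>R axis i 1))) (at 0)"
    by (rule has_derivative_compose)
  then have "((\<lambda>t::real. f (y + t *\<^sub>R axis i 1)) has_field_derivative D (axis i 1)) (at 0)"
    by (simp add: has_field_derivative_def linear_cmul[OF lin] mult_commute_abs)
  then show ?thesis
    unfolding partial_def by (rule DERIV_imp_deriv)
qed

lemma partial_eq_frechet_derivative:
  fixes f :: "real^'n \<Rightarrow> real"
  shows "f differentiable (at y) \<Longrightarrow> partial i f y = frechet_derivative f (at y) (axis i 1)"
  by (simp add: partial_has_derivative frechet_derivative_works)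

lemma has_derivative_partials:
  fixes f :: "real^'n \<Rightarrow> real"
  assumes "f differentiable (at y)"
  shows "(f has_derivative (\<lambda>h. \<Sum>i\<in>UNIV. partial i f y * h $ i)) (at y)"
proof -
  let ?D = "frechet_derivative f (at y)"
  have D: "(f has_derivative ?D) (at y)"
    using assms frechet_derivative_works by blast
  then have lin: "linear ?D"
    using has_derivative_linear by blast
  have "?D h = (\<Sum>i\<in>UNIV. partial i f y * h $ i)" for h
  proof -
    have "?D h = ?D (\<Sum>i\<in>UNIV. h $ i *\<^sub>R axis i 1)"
      using basis_expansion[of h] by (simp add: scalar_mult_eq_scaleR)
    also have "\<dots> = (\<Sum>i\<in>UNIV. h $ i * ?D (axis i 1))"
      by (simp add: linear_sum[OF lin] linear_cmul[OF lin])
    finally show ?thesis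
      by (simp add: partial_eq_frechet_derivative[OF assms] mult.commute)
  qed
  then show ?thesis
    using D by presburger
qed

lemma partial_cong:
  fixes f :: "real^'n \<Rightarrow> real"
  assumes "\<forall>\<^sub>F z in nhds y. f z = g z"
  shows "partial i f y = partial i g y"
  unfolding partial_def
proof (rule deriv_cong_ev[OF _ refl])
  have "((\<lambda>t::real. y + t *\<^sub>R axis i 1) \<longlongrightarrow> y + 0 *\<^sub>R axis i 1) (nhds 0)"
    by (intro tendsto_intros filterlim_ident)
  then have "filterlim (\<lambda>t::real. y + t *\<^sub>R axis i 1) (nhds y) (nhds 0)"
    by simp
  then show "\<forall>\<^sub>F t in nhds 0. f (y + t *\<^sub>R axis i 1) = g (y + t *\<^sub>R axis i 1)"
    using assms by (rule eventually_compose_filterlim[rotated])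
qed

text \<open>Agreement near \<open>y\<close> is agreement near every point close to \<open>y\<close>,
  so an identity of germs can be differentiated repeatedly.\<close>

lemma eventually_partial_cong:
  fixes f :: "real^'n \<Rightarrow> real"
  assumes "\<forall>\<^sub>F z in nhds y. f z = g z"
  shows "\<forall>\<^sub>F z in nhds y. partial i f z = partial i g z"
proof -
  have "\<forall>\<^sub>F z in nhds y. \<forall>\<^sub>F x in nhds z. f x = g x"
    using assms eventually_eventually by blast
  then show ?thesis
    by eventually_elim (rule partial_cong)
qed

lemma differentiable_cong_nhds:
  fixes f :: "'a::real_normed_vector \<Rightarrow> 'b::real_normed_vector"
  assumes "\<forall>\<^sub>F z in nhds y. f z = g z" and "f differentiable (at y)"
  shows "g differentiable (at y)"
proof -
  obtain D where "(f has_derivative D) (at y)"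
    using assms(2) differentiable_def by blast
  moreover have "\<forall>\<^sub>F z in at y. f z = g z"
    using assms(1) by (simp only: eventually_nhds_conv_at)
  moreover have "f y = g y"
    using eventually_nhds_x_imp_x[OF assms(1)] .
  ultimately have "(g has_derivative D) (at y)"
    by (rule has_derivative_transform_eventually) simp
  then show ?thesis
    using differentiable_def by blast
qed

lemma partial_const [simp]: "partial i (\<lambda>z. c) y = 0"
  by (simp add: partial_def)

lemma partial_component: "partial i (\<lambda>z. z $ j) y = (if i = j then 1 else 0)"
proof -
  have "((\<lambda>z. z $ j) has_derivative (\<lambda>z. z $ j)) (at y)"
    by (rule bounded_linear_imp_has_derivative) (rule bounded_linear_vec_nth)
  then show ?thesis
    by (simp add: partial_has_derivative axis_def)
qed

lemma differentiable_component [simp]: "(\<lambda>z::real^'n. z $ j) differentiable (at y within S)"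
  by (rule bounded_linear_imp_differentiable) (rule bounded_linear_vec_nth)

lemma partial_add:
  assumes "f differentiable (at y)" "g differentiable (at y)"
  shows "partial i (\<lambda>z. f z + g z) y = partial i f y + partial i g y"
  using assms
  by (simp add: partial_has_derivative[OF has_derivative_add] frechet_derivative_works
      partial_eq_frechet_derivative)

lemma partial_mult:
  assumes "f differentiable (at y)" "g differentiable (at y)"
  shows "partial i (\<lambda>z. f z * g z) y = partial i f y * g y + f y * partial i g y"
  using assms
  by (simp add: partial_has_derivative[OF has_derivative_mult] frechet_derivative_works
      partial_eq_frechet_derivative)

lemma partial_cmult:
  assumes "f differentiable (at y)"
  shows "partial i (\<lambda>z. c * f z) y = c * partial i f y"
  using partial_mult[of "\<lambda>z. c" y f i] assms by simp

lemma partial_sum: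
  assumes "finite I" "\<And>k. k \<in> I \<Longrightarrow> f k differentiable (at y)"
  shows "partial i (\<lambda>z. \<Sum>k\<in>I. f k z) y = (\<Sum>k\<in>I. partial i (f k) y)"
  using assms
proof (induction I rule: finite_induct)
  case (insert a I)
  then have "(\<lambda>z. \<Sum>k\<in>I. f k z) differentiable (at y)"
    by auto
  with insert show ?case
    by (simp add: partial_add)
qed simp

lemma partial_inverse:
  assumes "f differentiable (at y)" "f y \<noteq> 0"
  shows "partial i (\<lambda>z. inverse (f z)) y = - (inverse (f y) * partial i f y * inverse (f y))"
proof -
  have "(f has_derivative frechet_derivative f (at y)) (at y)"
    using assms frechet_derivative_works by blast
  from partial_has_derivative[OF Deriv.has_derivative_inverse[OF assms(2) this]] show ?thesis
    using assms(1) by (simp add: partial_eq_frechet_derivative)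
qed

lemma differentiable_vec:
  fixes u :: "'a::real_normed_vector \<Rightarrow> real^'n"
  assumes "\<And>b. (\<lambda>z. u z $ b) differentiable (at y)"
  shows "u differentiable (at y)"
proof -
  have "((\<lambda>z. u z $ b) has_derivative frechet_derivative (\<lambda>z. u z $ b) (at y)) (at y)" for b
    using assms frechet_derivative_works by blast
  then have "(u has_derivative (\<lambda>h. \<chi> b. frechet_derivative (\<lambda>z. u z $ b) (at y) h)) (at y)"
    by (subst has_derivative_componentwise_within)
       (auto simp: Basis_vec_def inner_axis)
  then show ?thesis
    using differentiable_def by blast
qed

lemma partial_chain:
  fixes u :: "real^'m \<Rightarrow> real^'n"
  assumes k: "k differentiable (at (u x))" and u: "\<And>b. (\<lambda>z. u z $ b) differentiable (at x)"
  shows "partial i (\<lambda>z. k (u z)) x = (\<Sum>b\<in>UNIV. partial b k (u x) * partial i (\<lambda>z. u z $ b) x)"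
proof -
  obtain D where D: "(u has_derivative D) (at x)"
    using differentiable_vec[OF u] differentiable_def by blast
  have Db: "partial i (\<lambda>z. u z $ b) x = D (axis i 1) $ b" for b
    by (rule partial_has_derivative)
       (rule bounded_linear.has_derivative[OF bounded_linear_vec_nth D])
  have "((\<lambda>z. k (u z)) has_derivative (\<lambda>h. \<Sum>b\<in>UNIV. partial b k (u x) * D h $ b)) (at x)"
    using has_derivative_compose[OF D has_derivative_partials[OF k]] .
  then show ?thesis
    by (simp add: partial_has_derivative Db)
qed

subsection \<open>Functions with finitely many derivatives at a point\<close>

text \<open>\<open>C_on\<close> needs an open set, but the highest derivatives are available at one
  point only. Level \<open>Suc k\<close> at \<open>y\<close> therefore asks for level
  \<open>k\<close> around \<open>y\<close>, and for level \<open>k\<close> of the partials at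
  \<open>y\<close> alone.\<close>

primrec kdiff :: "nat \<Rightarrow> (real^'n::finite \<Rightarrow> real) \<Rightarrow> real^'n \<Rightarrow> bool" where
  "kdiff 0 f y \<longleftrightarrow> True"
| "kdiff (Suc k) f y \<longleftrightarrow>
     f differentiable (at y) \<and> (\<forall>\<^sub>F z in nhds y. kdiff k f z) \<and> (\<forall>i. kdiff k (partial i f) y)"

lemma kdiff_cong:
  assumes "\<forall>\<^sub>F z in nhds y. f z = g z" and "kdiff k f y"
  shows "kdiff k g y"
  using assms
proof (induction k arbitrary: f g y)
  case (Suc k)
  have "\<forall>\<^sub>F z in nhds y. \<forall>\<^sub>F x in nhds z. f x = g x"
    using Suc.prems(1) eventually_eventually by blast
  moreover have "\<forall>\<^sub>F z in nhds y. kdiff k f z"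
    using Suc.prems(2) by simp
  ultimately have "\<forall>\<^sub>F z in nhds y. kdiff k g z"
    by eventually_elim (rule Suc.IH)
  moreover have "g differentiable (at y)"
    using Suc.prems differentiable_cong_nhds by auto
  moreover have "kdiff k (partial i g) y" for i
    using Suc.IH[OF eventually_partial_cong[OF Suc.prems(1)]] Suc.prems(2) by simp
  ultimately show ?case
    by simp
qed simp

lemma kdiff_SucD: "kdiff (Suc k) f y \<Longrightarrow> kdiff k f y"
  by (auto dest: eventually_nhds_x_imp_x)

lemma kdiff_mono:
  assumes "j \<le> k" "kdiff k f y"
  shows "kdiff j f y"
  using assms by (induction rule: inc_induct) (auto dest: kdiff_SucD simp del: kdiff.simps)

lemma kdiff_differentiable: "kdiff k f y \<Longrightarrow> 0 < k \<Longrightarrow> f differentiable (at y)"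
  by (cases k) auto

lemma kdiff_partial: "kdiff (Suc k) f y \<Longrightarrow> kdiff k (partial i f) y"
  by simp

lemma kdiff_eventually: "kdiff (Suc k) f y \<Longrightarrow> \<forall>\<^sub>F z in nhds y. kdiff k f z"
  by simp

lemma kdiff_eventually_differentiable:
  "kdiff (Suc k) f y \<Longrightarrow> 0 < k \<Longrightarrow> \<forall>\<^sub>F z in nhds y. f differentiable (at z)"
  using kdiff_differentiable by (fastforce elim: eventually_mono)

text \<open>The entry point for the fifth order: level \<open>k\<close> around the point, plus
  differentiability of the partials of order \<open>k\<close> at the point itself, is one level
  more.\<close>

lemma kdiff_SucI:
  assumes "\<forall>\<^sub>F z in nhds w. kdiff k f z"
    and "\<And>is. length is = k \<Longrightarrow> foldr partial is f differentiable (at w)"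
  shows "kdiff (Suc k) f w"
  using assms
proof (induction k arbitrary: f)
  case (Suc k)
  have "kdiff (Suc k) (partial i f) w" for i
  proof (rule Suc.IH)
    show "\<forall>\<^sub>F z in nhds w. kdiff k (partial i f) z"
      using Suc.prems(1) by eventually_elim simp
    show "foldr partial is (partial i f) differentiable (at w)" if "length is = k" for "is"
      \<comment> \<open>\<open>foldr partial\<close> applies the last index of the list first, so
        the new index is appended at the end.\<close>
      using Suc.prems(2)[of "is @ [i]"] that by simp
  qed
  moreover have "f differentiable (at w)"
    using eventually_nhds_x_imp_x[OF Suc.prems(1)] by simp
  ultimately show ?case
    using Suc.prems(1) unfolding kdiff.simps(2)[of "Suc k"] by blast
qed simp

text \<open>Pattern of the closure proofs below: a differentiation rule gives
  \<open>partial i f\<close> a closed form near \<open>y\<close>, and the level is read off that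
  form.\<close>

lemma kdiff_partialI:
  assumes "\<forall>\<^sub>F z in nhds y. partial i f z = g z" and "kdiff k g y"
  shows "kdiff k (partial i f) y"
proof (rule kdiff_cong[OF _ assms(2)])
  show "\<forall>\<^sub>F z in nhds y. g z = partial i f z"
    using assms(1) by eventually_elim simp
qed

lemma kdiff_const: "kdiff k (\<lambda>z. c) y"
proof (induction k arbitrary: c y)
  case (Suc k)
  have "partial i (\<lambda>z. c) = (\<lambda>z. 0)" for i :: 'a
    by auto
  with Suc show ?case
    by simp
qed simp

lemma kdiff_component: "kdiff k (\<lambda>z. z $ j) y"
proof (induction k arbitrary: y)
  case (Suc k)
  have "partial i (\<lambda>z. z $ j) = (\<lambda>z. if i = j then 1 else 0)" for i
    by (auto simp: partial_component)
  with Suc show ?case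
    by (simp add: kdiff_const)
qed simp

lemma kdiff_add:
  assumes "kdiff k f y" "kdiff k g y"
  shows "kdiff k (\<lambda>z. f z + g z) y"
  using assms
proof (induction k arbitrary: f g y)
  case (Suc k)
  have "kdiff k (partial i (\<lambda>z. f z + g z)) y" for i
  \<comment> \<open>At \<open>k = 0\<close> the summands are known to be differentiable at
    \<open>y\<close> only, so the sum rule does not extend to a neighbourhood; but level 0 demands
    nothing.\<close>
  proof (cases "k = 0")
    case False
    show ?thesis
    proof (rule kdiff_partialI)
      have "\<forall>\<^sub>F z in nhds y. f differentiable (at z)" "\<forall>\<^sub>F z in nhds y. g differentiable (at z)"
        using Suc.prems[THEN kdiff_eventually_differentiable] False by blast+
      then show "\<forall>\<^sub>F z in nhds y. partial i (\<lambda>z. f z + g z) z = partial i f z + partial i g z"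
        by eventually_elim (rule partial_add)
    qed (use Suc in auto)
  qed simp
  moreover have "\<forall>\<^sub>F z in nhds y. kdiff k (\<lambda>z. f z + g z) z"
    using Suc.prems[THEN kdiff_eventually] by eventually_elim (rule Suc.IH)
  ultimately show ?case
    using Suc.prems by simp
qed simp

lemma kdiff_mult:
  assumes "kdiff k f y" "kdiff k g y"
  shows "kdiff k (\<lambda>z. f z * g z) y"
  using assms
proof (induction k arbitrary: f g y)
  case (Suc k)
  have "kdiff k (partial i (\<lambda>z. f z * g z)) y" for i
  proof (cases "k = 0")
    case False
    show ?thesis
    proof (rule kdiff_partialI)
      have "\<forall>\<^sub>F z in nhds y. f differentiable (at z)" "\<forall>\<^sub>F z in nhds y. g differentiable (at z)"
        using Suc.prems[THEN kdiff_eventually_differentiable] False by blast+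
      then show "\<forall>\<^sub>F z in nhds y. partial i (\<lambda>z. f z * g z) z = partial i f z * g z + f z * partial i g z"
        by eventually_elim (rule partial_mult)
    qed (use Suc.prems Suc.IH kdiff_SucD kdiff_add in \<open>metis kdiff_partial\<close>)
  qed simp
  moreover have "\<forall>\<^sub>F z in nhds y. kdiff k (\<lambda>z. f z * g z) z"
    using Suc.prems[THEN kdiff_eventually] by eventually_elim (rule Suc.IH)
  ultimately show ?case
    using Suc.prems by simp
qed simp

lemma kdiff_uminus: "kdiff k f y \<Longrightarrow> kdiff k (\<lambda>z. - f z) y"
  using kdiff_mult[OF kdiff_const[of k "- 1"]] by simp

lemma kdiff_sum:
  assumes "finite I" "\<And>a. a \<in> I \<Longrightarrow> kdiff k (f a) y"
  shows "kdiff k (\<lambda>z. \<Sum>a\<in>I. f a z) y"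
  using assms by (induction I rule: finite_induct) (auto simp: kdiff_const kdiff_add)

lemma kdiff_prod:
  assumes "finite I" "\<And>a. a \<in> I \<Longrightarrow> kdiff k (f a) y"
  shows "kdiff k (\<lambda>z. \<Prod>a\<in>I. f a z) y"
  using assms by (induction I rule: finite_induct) (auto simp: kdiff_const kdiff_mult)

lemma eventually_nonzero:
  fixes f :: "'a::real_normed_vector \<Rightarrow> real"
  assumes "f differentiable (at y)" "f y \<noteq> 0"
  shows "\<forall>\<^sub>F z in nhds y. f z \<noteq> 0"
proof -
  have "isCont f y"
    using assms(1) by (rule differentiable_imp_continuous_within)
  then have "(f \<longlongrightarrow> f y) (nhds y)"
    by (simp add: continuous_at_imp_continuous_at_within isCont_def tendsto_at_iff_tendsto_nhds)
  then show ?thesis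
    using assms(2) tendsto_imp_eventually_ne by blast
qed

text \<open>The derivative of 1/f contains 1/f again, but one level lower, where the induction
  hypothesis applies. Continuity keeps \<open>f\<close> away from 0 near \<open>y\<close>.\<close>

lemma kdiff_inverse:
  assumes "kdiff k f y" "f y \<noteq> 0"
  shows "kdiff k (\<lambda>z. inverse (f z)) y"
  using assms
proof (induction k arbitrary: y)
  case (Suc k)
  have d: "f differentiable (at y)"
    using Suc.prems by simp
  have nz: "\<forall>\<^sub>F z in nhds y. f z \<noteq> 0"
    using eventually_nonzero[OF d Suc.prems(2)] .
  have "kdiff k (partial i (\<lambda>z. inverse (f z))) y" for i
  proof (cases "k = 0")
    case False
    have inv: "kdiff k (\<lambda>z. inverse (f z)) y"
      using Suc kdiff_SucD by blast
    show ?thesis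
    proof (rule kdiff_partialI)
      have "\<forall>\<^sub>F z in nhds y. f differentiable (at z)"
        using kdiff_eventually_differentiable[OF Suc.prems(1)] False by blast
      then show "\<forall>\<^sub>F z in nhds y. partial i (\<lambda>z. inverse (f z)) z
          = - (inverse (f z) * partial i f z * inverse (f z))"
        using nz by eventually_elim (rule partial_inverse)
    qed (use Suc.prems inv in \<open>intro kdiff_uminus kdiff_mult kdiff_partial\<close>)
  qed simp
  moreover have "\<forall>\<^sub>F z in nhds y. kdiff k (\<lambda>z. inverse (f z)) z"
    using kdiff_eventually[OF Suc.prems(1)] nz by eventually_elim (rule Suc.IH)
  ultimately show ?case
    using d Suc.prems by simp
qed simp

section \<open>Determinants and inverses of matrices depending on a point\<close>

lemma kdiff_det:
  fixes M :: "real^'n \<Rightarrow> real^'m^'m"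
  assumes "\<And>a b. kdiff k (\<lambda>z. M z $ a $ b) y"
  shows "kdiff k (\<lambda>z. det (M z)) y"
  unfolding det_def
  by (intro kdiff_sum kdiff_mult kdiff_const kdiff_prod assms finite_permutations finite)

lemma matrix_inv:
  fixes M :: "real^'n^'n"
  assumes "det M \<noteq> 0"
  shows "M ** matrix_inv M = mat 1" "matrix_inv M ** M = mat 1"
  using assms someI_ex[of "\<lambda>A'. M ** A' = mat 1 \<and> A' ** M = mat 1"]
  unfolding matrix_inv_def invertible_det_nz[symmetric] invertible_def by auto

lemma matrix_inv_unique:
  fixes M N :: "real^'n^'n"
  assumes "N ** M = mat 1"
  shows "matrix_inv M = N"
proof -
  have "det M \<noteq> 0"
    using assms by (metis det_I det_mul mult_zero_right zero_neq_one)
  then have "N ** (M ** matrix_inv M) = N"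
    by (simp add: matrix_inv matrix_mul_rid)
  then show ?thesis
    using assms by (simp add: matrix_mul_assoc matrix_mul_lid)
qed

text \<open>\<open>matrix_inv\<close> is a choice operator, hence opaque to calculus. Cramer's rule
  makes its entries rational functions of the entries of \<open>M\<close>.\<close>

lemma matrix_inv_cramer:
  fixes M :: "real^'n^'n"
  assumes "det M \<noteq> 0"
  shows "matrix_inv M $ r $ m =
    det (\<chi> i j. if j = r then (if i = m then 1 else 0) else M $ i $ j) * inverse (det M)"
proof -
  have "M *v (matrix_inv M *v axis m 1) = axis m 1"
    by (simp add: matrix_vector_mul_assoc matrix_inv[OF assms])
  then have "matrix_inv M *v axis m 1
      = (\<chi> k. det (\<chi> i j. if j = k then axis m 1 $ i else M $ i $ j) / det M)"
    using cramer[OF assms] by blast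
  then have "(matrix_inv M *v axis m 1) $ r = det (\<chi> i j. if j = r then axis m 1 $ i else M $ i $ j) / det M"
    by simp
  moreover have "(matrix_inv M *v axis m 1) $ r = matrix_inv M $ r $ m"
    by (simp add: matrix_vector_mult_basis column_def)
  ultimately show ?thesis
    by (simp add: axis_def divide_inverse cong: if_cong)
qed

lemma kdiff_matrix_inv:
  fixes M :: "real^'n \<Rightarrow> real^'m^'m"
  assumes M: "\<And>a b. kdiff k (\<lambda>z. M z $ a $ b) y" and nz: "det (M y) \<noteq> 0"
  shows "kdiff k (\<lambda>z. matrix_inv (M z) $ r $ m) y"
proof (cases "k = 0")
  case False
  have "(\<lambda>z. det (M z)) differentiable (at y)"
    using kdiff_det[OF M] False kdiff_differentiable by blast
  then have "\<forall>\<^sub>F z in nhds y. det (M z) \<noteq> 0"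
    using eventually_nonzero nz by blast
  then have ev: "\<forall>\<^sub>F z in nhds y.
      det (\<chi> i j. if j = r then (if i = m then 1 else 0) else M z $ i $ j) * inverse (det (M z))
        = matrix_inv (M z) $ r $ m"
    by eventually_elim (simp add: matrix_inv_cramer)
  have "kdiff k (\<lambda>z. (\<chi> i j. if j = r then (if i = m then 1 else 0) else M z $ i $ j) $ a $ b) y" for a b
    by (cases "b = r") (auto simp: M kdiff_const)
  then show ?thesis
    by (intro kdiff_cong[OF ev] kdiff_mult kdiff_inverse kdiff_det M nz)
qed simp

lemma kdiff_1_iff: "kdiff 1 f y \<longleftrightarrow> f differentiable (at y)"
  by simp

text \<open>Index form of d(M^-1) = - M^-1 dM M^-1: the identity M^-1 M = 1, valid wherever the
  determinant stays nonzero, is differentiated and multiplied by M^-1 from the right.\<close>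

lemma partial_matrix_inv:
  fixes M :: "real^'n \<Rightarrow> real^'m^'m"
  assumes M: "\<And>a b. (\<lambda>z. M z $ a $ b) differentiable (at y)" and nz: "det (M y) \<noteq> 0"
  shows "partial i (\<lambda>z. matrix_inv (M z) $ r $ m) y =
    - (\<Sum>a\<in>UNIV. \<Sum>b\<in>UNIV. matrix_inv (M y) $ r $ a * partial i (\<lambda>z. M z $ a $ b) y * matrix_inv (M y) $ b $ m)"
proof -
  let ?N = "\<lambda>z. matrix_inv (M z)"
  have N: "(\<lambda>z. ?N z $ a $ b) differentiable (at y)" for a b
    using kdiff_matrix_inv[of 1 M y] M nz by (simp add: kdiff_1_iff)
  have "(\<lambda>z. det (M z)) differentiable (at y)"
    using kdiff_det[of 1 M y] M by (simp add: kdiff_1_iff)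
  then have "\<forall>\<^sub>F z in nhds y. det (M z) \<noteq> 0"
    using eventually_nonzero nz by blast
  then have "\<forall>\<^sub>F z in nhds y. (\<Sum>a\<in>UNIV. ?N z $ r $ a * M z $ a $ b) = mat 1 $ r $ b" for b
    by eventually_elim (simp add: matrix_inv(2)[symmetric] matrix_matrix_mult_def)
  then have "partial i (\<lambda>z. \<Sum>a\<in>UNIV. ?N z $ r $ a * M z $ a $ b) y = 0" for b
    using partial_cong[where g = "\<lambda>z. mat 1 $ r $ b"] by force
  then have *: "(\<Sum>a\<in>UNIV. partial i (\<lambda>z. ?N z $ r $ a) y * M y $ a $ b)
      = - (\<Sum>a\<in>UNIV. ?N y $ r $ a * partial i (\<lambda>z. M z $ a $ b) y)" for b
    by (simp add: partial_sum partial_mult M N sum.distrib add_eq_0_iff2)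
  have MN: "(\<Sum>b\<in>UNIV. M y $ a $ b * ?N y $ b $ m) = (if a = m then 1 else 0)" for a
    using arg_cong[OF matrix_inv(1)[OF nz], of "\<lambda>K. K $ a $ m"]
    by (simp add: matrix_matrix_mult_def mat_def)
  have "partial i (\<lambda>z. ?N z $ r $ m) y
      = (\<Sum>a\<in>UNIV. partial i (\<lambda>z. ?N z $ r $ a) y * (\<Sum>b\<in>UNIV. M y $ a $ b * ?N y $ b $ m))"
    unfolding MN
    by (simp add: if_distrib cong: if_cong)
  also have "\<dots> = (\<Sum>b\<in>UNIV. (\<Sum>a\<in>UNIV. partial i (\<lambda>z. ?N z $ r $ a) y * M y $ a $ b) * ?N y $ b $ m)"
    unfolding sum_distrib_left sum_distrib_right by (subst sum.swap) (simp add: mult.assoc)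
  also have "\<dots> = - (\<Sum>b\<in>UNIV. \<Sum>a\<in>UNIV. ?N y $ r $ a * partial i (\<lambda>z. M z $ a $ b) y * ?N y $ b $ m)"
    unfolding * by (simp add: sum_negf sum_distrib_right)
  finally show ?thesis
    by (subst sum.swap)
qed

subsection \<open>Iterated partial derivatives of linear combinations\<close>

lemma foldr_partial_cong:
  assumes "\<forall>\<^sub>F z in nhds y. f z = g z"
  shows "foldr partial is f y = foldr partial is g y"
proof -
  have "\<forall>\<^sub>F z in nhds y. foldr partial is f z = foldr partial is g z"
    by (induction "is") (use assms in \<open>auto intro: eventually_partial_cong\<close>)
  then show ?thesis
    by (rule eventually_nhds_x_imp_x)
qed

text \<open>Bookkeeping for the linearity rules below: each index in the list costs one
  level.\<close>

lemma kdiff_foldr_partial: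
  "kdiff (k + length is) f y \<Longrightarrow> kdiff k (foldr partial is f) y"
proof (induction "is" arbitrary: k)
  case (Cons i "is")
  then have "kdiff (Suc k) (foldr partial is f) y"
    by (simp del: kdiff.simps)
  then show ?case
    by simp
qed simp

lemma foldr_partial_differentiable:
  "kdiff (Suc (length is)) f y \<Longrightarrow> foldr partial is f differentiable (at y)"
  using kdiff_foldr_partial[of "Suc 0" "is" f y] by simp

lemma foldr_partial_add:
  assumes "kdiff (length is) f y" "kdiff (length is) g y"
  shows "foldr partial is (\<lambda>z. f z + g z) y = foldr partial is f y + foldr partial is g y"
  using assms
proof (induction "is" arbitrary: y)
  case (Cons i "is")
  have *: "\<forall>\<^sub>F z in nhds y. kdiff (length is) f z" "\<forall>\<^sub>F z in nhds y. kdiff (length is) g z"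
    using Cons.prems by auto
  then have "\<forall>\<^sub>F z in nhds y. foldr partial is (\<lambda>z. f z + g z) z = foldr partial is f z + foldr partial is g z"
    by eventually_elim (rule Cons.IH)
  then have "foldr partial (i # is) (\<lambda>z. f z + g z) y
      = partial i (\<lambda>z. foldr partial is f z + foldr partial is g z) y"
    by (simp add: partial_cong)
  moreover have "foldr partial is f differentiable (at y)" "foldr partial is g differentiable (at y)"
    using Cons.prems foldr_partial_differentiable by (simp_all del: kdiff.simps)
  ultimately show ?case
    by (simp add: partial_add)
qed simp

lemma foldr_partial_cmult:
  assumes "kdiff (length is) f y"
  shows "foldr partial is (\<lambda>z. c * f z) y = c * foldr partial is f y"
  using assms
proof (induction "is" arbitrary: y)
  case (Cons i "is")
  have "\<forall>\<^sub>F z in nhds y. kdiff (length is) f z"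
    using Cons.prems by auto
  then have "\<forall>\<^sub>F z in nhds y. foldr partial is (\<lambda>z. c * f z) z = c * foldr partial is f z"
    by eventually_elim (rule Cons.IH)
  then have "foldr partial (i # is) (\<lambda>z. c * f z) y = partial i (\<lambda>z. c * foldr partial is f z) y"
    by (simp add: partial_cong)
  moreover have "foldr partial is f differentiable (at y)"
    using Cons.prems foldr_partial_differentiable by (simp_all del: kdiff.simps)
  ultimately show ?case
    by (simp add: partial_cmult)
qed simp

lemma foldr_partial_zero: "foldr partial is (\<lambda>z. 0) y = 0"
  using foldr_partial_cmult[OF kdiff_const, of "is" 0 0] by simp

lemma foldr_partial_sum:
  assumes "finite I" "\<And>a. a \<in> I \<Longrightarrow> kdiff (length is) (f a) y"
  shows "foldr partial is (\<lambda>z. \<Sum>a\<in>I. f a z) y = (\<Sum>a\<in>I. foldr partial is (f a) y)"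
  using assms
  by (induction I rule: finite_induct) (simp_all add: foldr_partial_zero foldr_partial_add kdiff_sum)

lemma foldr_partial_sum_cmult:
  fixes c :: "'i::finite \<Rightarrow> real"
  assumes "\<And>a. kdiff (length is) (f a) y"
  shows "foldr partial is (\<lambda>z. \<Sum>a\<in>UNIV. c a * f a z) y = (\<Sum>a\<in>UNIV. c a * foldr partial is (f a) y)"
  using assms by (simp add: foldr_partial_sum foldr_partial_cmult kdiff_mult kdiff_const)

lemma partial_partial_component: "partial i (partial j (\<lambda>z. z $ k)) y = 0"
  by (simp add: partial_component[abs_def])

lemma partial_partial_partial_component_mult:
  "partial a (partial b (partial c (\<lambda>z. z $ i * z $ j))) y = 0"
proof -
  have 1: "partial c (\<lambda>z. z $ i * z $ j)
      = (\<lambda>z. (if c = i then 1 else 0) * z $ j + (if c = j then 1 else 0) * z $ i)" for c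
    by (auto simp: partial_mult partial_component)
  have "partial b (\<lambda>z. p * z $ j + q * z $ i)
      = (\<lambda>z. p * (if b = j then 1 else 0) + q * (if b = i then 1 else 0))" for b and p q :: real
    by (auto simp: partial_add partial_cmult partial_component differentiable_mult)
  then show ?thesis
    unfolding 1 by simp
qed

subsection \<open>Linear change of variables\<close>

lemma partial_linear:
  fixes M :: "real^'n^'m"
  assumes "k differentiable (at (M *v y))"
  shows "partial i (\<lambda>z. k (M *v z)) y = (\<Sum>c\<in>UNIV. M $ c $ i * partial c k (M *v y))"
proof -
  have d: "(\<lambda>z. (M *v z) $ b) differentiable (at y)" for b
    by (simp add: matrix_vector_mult_def differentiable_mult)
  have "partial i (\<lambda>z. (M *v z) $ b) y = M $ b $ i" for b
    by (simp add: matrix_vector_mult_def partial_sum partial_cmult partial_component differentiable_mult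
        if_distrib cong: if_cong)
  then show ?thesis
    using partial_chain[OF assms d] by (simp add: mult.commute)
qed

lemma eventually_linear:
  fixes M :: "real^'n^'m"
  assumes "\<forall>\<^sub>F z in nhds (M *v y). P z"
  shows "\<forall>\<^sub>F z in nhds y. P (M *v z)"
proof -
  have "isCont ((*v) M) y"
    by (intro linear_continuous_at) (simp add: linear_linear)
  then have "filterlim ((*v) M) (nhds (M *v y)) (nhds y)"
    by (simp add: isCont_def tendsto_at_iff_tendsto_nhds)
  then show ?thesis
    using assms eventually_compose_filterlim by blast
qed

lemma partial_linear_eventually:
  fixes M :: "real^'n^'m"
  assumes "\<forall>\<^sub>F z in nhds (M *v y). k differentiable (at z)"
  shows "\<forall>\<^sub>F z in nhds y. partial i (\<lambda>z. k (M *v z)) z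
    = (\<lambda>z. \<Sum>c\<in>UNIV. M $ c $ i * partial c k z) (M *v z)"
  using eventually_linear[OF assms] by eventually_elim (rule partial_linear)

lemma kdiff_linear:
  fixes M :: "real^'n^'m"
  assumes "kdiff k g (M *v y)"
  shows "kdiff k (\<lambda>z. g (M *v z)) y"
  using assms
proof (induction k arbitrary: g y)
  case (Suc k)
  have "(\<lambda>z. g (M *v z)) differentiable (at y)"
  proof (rule differentiable_compose[of g])
    show "(*v) M differentiable at y"
      by (intro linear_imp_differentiable) simp
  qed (use Suc.prems in auto)
  moreover have "\<forall>\<^sub>F z in nhds y. kdiff k (\<lambda>z. g (M *v z)) z"
    using eventually_linear[OF kdiff_eventually[OF Suc.prems]] by eventually_elim (rule Suc.IH)
  moreover have "kdiff k (partial i (\<lambda>z. g (M *v z))) y" for i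
  proof (cases "k = 0")
    case False
    show ?thesis
      by (rule kdiff_partialI[OF partial_linear_eventually Suc.IH])
        (use Suc.prems False kdiff_eventually_differentiable in \<open>auto intro!: kdiff_sum kdiff_mult kdiff_const\<close>)
  qed simp
  ultimately show ?case
    by simp
qed simp

text \<open>A linear substitution has no higher derivatives, so third partials transform as a
  tensor. After one and two derivatives the result is again a function composed with
  \<open>M\<close>, namely \<open>k1\<close> and \<open>k2\<close>.\<close>

lemma partial3_linear:
  fixes M :: "real^'n^'m"
  assumes k: "kdiff 3 k (M *v y)"
  shows "partial \<alpha> (partial \<beta> (partial \<gamma> (\<lambda>z. k (M *v z)))) y =
    (\<Sum>a\<in>UNIV. M $ a $ \<alpha> * (\<Sum>b\<in>UNIV. M $ b $ \<beta> * (\<Sum>c\<in>UNIV. M $ c $ \<gamma> *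
       partial a (partial b (partial c k)) (M *v y))))"
proof -
  have k3: "kdiff (Suc (Suc (Suc 0))) k (M *v y)"
    using k by (simp add: numeral_3_eq_3)
  define k1 where "k1 = (\<lambda>z. \<Sum>c\<in>UNIV. M $ c $ \<gamma> * partial c k z)"
  define k2 where "k2 = (\<lambda>z. \<Sum>b\<in>UNIV. M $ b $ \<beta> * partial b k1 z)"
  have k1: "kdiff (Suc (Suc 0)) k1 (M *v y)"
    unfolding k1_def by (intro kdiff_sum kdiff_mult kdiff_const kdiff_partial k3 finite)
  then have k2: "kdiff (Suc 0) k2 (M *v y)"
    unfolding k2_def by (intro kdiff_sum kdiff_mult kdiff_const kdiff_partial finite)
  have "\<forall>\<^sub>F z in nhds y. partial \<gamma> (\<lambda>z. k (M *v z)) z = k1 (M *v z)"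
    using partial_linear_eventually[OF kdiff_eventually_differentiable[OF k3]] by (simp add: k1_def)
  then have "partial \<alpha> (partial \<beta> (partial \<gamma> (\<lambda>z. k (M *v z)))) y
      = partial \<alpha> (partial \<beta> (\<lambda>z. k1 (M *v z))) y"
    by (intro partial_cong eventually_partial_cong)
  also have "\<dots> = partial \<alpha> (\<lambda>z. k2 (M *v z)) y"
    using partial_linear_eventually[OF kdiff_eventually_differentiable[OF k1]]
    by (intro partial_cong) (simp add: k2_def)
  also have "\<dots> = (\<Sum>a\<in>UNIV. M $ a $ \<alpha> * partial a k2 (M *v y))"
    using k2 by (simp add: partial_linear)
  finally have 1: "partial \<alpha> (partial \<beta> (partial \<gamma> (\<lambda>z. k (M *v z)))) y
      = (\<Sum>a\<in>UNIV. M $ a $ \<alpha> * partial a k2 (M *v y))" .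
  have 2: "partial a k2 (M *v y) = (\<Sum>b\<in>UNIV. M $ b $ \<beta> * partial a (partial b k1) (M *v y))" for a
    using foldr_partial_sum_cmult[of "[a]" "\<lambda>b. partial b k1"] k1 by (simp add: k2_def)
  have "partial a (partial b k1) (M *v y)
      = (\<Sum>c\<in>UNIV. M $ c $ \<gamma> * partial a (partial b (partial c k)) (M *v y))" for a b
    using foldr_partial_sum_cmult[of "[a, b]" "\<lambda>c. partial c k"] kdiff_partial[OF k3] by (simp add: k1_def)
  then show ?thesis
    by (simp add: 1 2)
qed

subsection \<open>Equality of mixed partial derivatives\<close>

lemma has_field_derivative_line:
  fixes g :: "real^'n \<Rightarrow> real"
  assumes "g differentiable (at (u + s *\<^sub>R axis i 1))"
  shows "((\<lambda>s. g (u + s *\<^sub>R axis i 1)) has_field_derivative partial i g (u + s *\<^sub>R axis i 1)) (at s)"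
proof -
  have "((\<lambda>s. u + s *\<^sub>R axis i 1) has_derivative (\<lambda>t. t *\<^sub>R axis i 1)) (at s)"
    by (auto intro!: derivative_eq_intros)
  from has_derivative_compose[OF this has_derivative_partials[OF assms]]
  show ?thesis
    by (simp add: has_field_derivative_def axis_def if_distrib mult_commute_abs cong: if_cong)
qed

text \<open>The mean value theorem in direction \<open>i\<close>, applied to \<phi>(s) = g(w + t e_j
  + s e_i) - g(w + s e_i), turns the second difference into t \<phi>'(\<xi>). Linearising
  \<open>partial i g\<close> at \<open>w\<close> at both shifted points cancels the unknown \<xi>
  e_i and leaves t D(e_j) up to o(t).\<close>

lemma second_difference_tendsto:
  fixes g :: "real^'n \<Rightarrow> real"
  assumes g: "\<forall>\<^sub>F z in nhds w. g differentiable (at z)" and gi: "partial i g differentiable (at w)"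
  shows "((\<lambda>t. (g (w + t *\<^sub>R axis i 1 + t *\<^sub>R axis j 1) - g (w + t *\<^sub>R axis i 1)
      - g (w + t *\<^sub>R axis j 1) + g w) / t\<^sup>2) \<longlongrightarrow> partial j (partial i g) w) (at_right 0)"
proof (rule tendstoI)
  fix \<epsilon> :: real
  assume "\<epsilon> > 0"
  \<comment> \<open>The two linearisation errors are at most \<epsilon>/4 times 2t and \<epsilon>/4
    times t; together 3/4 \<epsilon> t, strictly below \<epsilon> t.\<close>
  then have \<epsilon>: "\<epsilon> / 4 > 0"
    by simp
  define D where "D = frechet_derivative (partial i g) (at w)"
  have D: "(partial i g has_derivative D) (at w)"
    using gi frechet_derivative_works D_def by blast
  then have lin: "linear D"
    using has_derivative_linear by blast
  obtain d1 where d1: "d1 > 0"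
      "\<And>z. norm (z - w) < d1 \<Longrightarrow> norm (partial i g z - partial i g w - D (z - w)) \<le> \<epsilon> / 4 * norm (z - w)"
    using D \<epsilon> unfolding has_derivative_at_alt by blast
  obtain d2 where d2: "d2 > 0" "\<And>z. dist z w < d2 \<Longrightarrow> g differentiable (at z)"
    using g unfolding eventually_nhds_metric by blast
  let ?ei = "axis i 1 :: real^'n" and ?ej = "axis j 1 :: real^'n"
  let ?\<Delta> = "\<lambda>t. g (w + t *\<^sub>R ?ei + t *\<^sub>R ?ej) - g (w + t *\<^sub>R ?ei) - g (w + t *\<^sub>R ?ej) + g w"
  \<comment> \<open>The displacements have norm at most 2t, hence half of \<open>min d1 d2\<close>
    keeps all points in both balls.\<close>
  have "dist (?\<Delta> t / t\<^sup>2) (partial j (partial i g) w) < \<epsilon>" if t: "0 < t" "t < min d1 d2 / 2" for t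
  proof -
    have small: "norm (t *\<^sub>R ?ej + s *\<^sub>R ?ei) \<le> 2 * t" "norm (s *\<^sub>R ?ei) \<le> t" if "0 \<le> s" "s \<le> t" for s
      using that t norm_triangle_ineq[of "t *\<^sub>R ?ej" "s *\<^sub>R ?ei"] by (auto simp: norm_axis_1)
    have near: "norm (t *\<^sub>R ?ej + s *\<^sub>R ?ei) < min d1 d2" "norm (s *\<^sub>R ?ei) < min d1 d2" if "0 \<le> s" "s \<le> t" for s
      using small[OF that] t by linarith+
    define \<phi> where "\<phi> = (\<lambda>s. g ((w + t *\<^sub>R ?ej) + s *\<^sub>R ?ei) - g (w + s *\<^sub>R ?ei))"
    define \<phi>' where "\<phi>' = (\<lambda>s. partial i g ((w + t *\<^sub>R ?ej) + s *\<^sub>R ?ei) - partial i g (w + s *\<^sub>R ?ei))"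
    have "(\<phi> has_field_derivative \<phi>' s) (at s)" if "0 \<le> s" "s \<le> t" for s
      unfolding \<phi>_def \<phi>'_def
      by (intro DERIV_diff has_field_derivative_line d2)
        (use near[OF that] in \<open>auto simp: dist_norm add.assoc\<close>)
    then obtain \<xi> where \<xi>: "0 < \<xi>" "\<xi> < t" "\<phi> t - \<phi> 0 = (t - 0) * \<phi>' \<xi>"
      using MVT2[of 0 t \<phi> \<phi>'] t by blast
    have \<Delta>: "?\<Delta> t = t * \<phi>' \<xi>"
      using \<xi>(3) by (simp add: \<phi>_def algebra_simps)
    let ?v1 = "t *\<^sub>R ?ej + \<xi> *\<^sub>R ?ei" and ?v2 = "\<xi> *\<^sub>R ?ei"
    have "\<bar>partial i g (w + ?v1) - partial i g w - D ?v1\<bar> \<le> \<epsilon> / 4 * norm ?v1"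
         "\<bar>partial i g (w + ?v2) - partial i g w - D ?v2\<bar> \<le> \<epsilon> / 4 * norm ?v2"
      using d1(2)[of "w + ?v1"] d1(2)[of "w + ?v2"] near[of \<xi>] \<xi> by auto
    moreover have "\<epsilon> / 4 * norm ?v1 \<le> \<epsilon> / 4 * (2 * t)" "\<epsilon> / 4 * norm ?v2 \<le> \<epsilon> / 4 * t"
      using small[of \<xi>] \<xi> \<epsilon> by (auto intro: mult_left_mono)
    moreover have "D ?v1 - D ?v2 = t * D ?ej"
      by (simp add: linear_add[OF lin] linear_cmul[OF lin])
    moreover have "\<phi>' \<xi> = partial i g (w + ?v1) - partial i g (w + ?v2)"
      by (simp add: \<phi>'_def add.assoc)
    ultimately have "\<bar>\<phi>' \<xi> - t * D ?ej\<bar> \<le> \<epsilon> / 4 * (3 * t)"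
      by linarith
    then have "\<bar>\<phi>' \<xi> / t - D ?ej\<bar> \<le> \<epsilon> / 4 * 3"
      using t by (simp add: field_simps abs_le_iff)
    moreover have "?\<Delta> t / t\<^sup>2 = \<phi>' \<xi> / t"
      using t by (simp add: \<Delta> power2_eq_square)
    ultimately show ?thesis
      using \<open>\<epsilon> > 0\<close> partial_has_derivative[OF D, of j] by (simp add: dist_real_def)
  qed
  then show "\<forall>\<^sub>F t in at_right 0. dist (?\<Delta> t / t\<^sup>2) (partial j (partial i g) w) < \<epsilon>"
    unfolding eventually_at_right_field
    using d1(1) d2(1) by (intro exI[of _ "min d1 d2 / 2"]) auto
qed

text \<open>Young's form of the theorem: both mixed derivatives are limits of the same second difference,
  and only differentiability of the first derivatives at the point is needed.\<close>

lemma partial_commute: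
  assumes "kdiff (Suc (Suc 0)) g w"
  shows "partial i (partial j g) w = partial j (partial i g) w"
proof -
  have g: "\<forall>\<^sub>F z in nhds w. g differentiable (at z)" and d: "\<And>i. partial i g differentiable (at w)"
    using assms kdiff_eventually_differentiable[OF assms] by auto
  have "((\<lambda>t. (g (w + t *\<^sub>R axis i 1 + t *\<^sub>R axis j 1) - g (w + t *\<^sub>R axis i 1)
      - g (w + t *\<^sub>R axis j 1) + g w) / t\<^sup>2) \<longlongrightarrow> partial i (partial j g) w) (at_right 0)"
    using second_difference_tendsto[OF g d, of j i] by (simp add: algebra_simps)
  from tendsto_unique[OF _ this second_difference_tendsto[OF g d]] show ?thesis
    by simp
qed

subsection \<open>Smooth functions on a vector space in terms of a basis\<close>

lemma C_on_SucD: "C_on (Suc k) f S \<Longrightarrow> C_on k f S"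
proof (induction k arbitrary: f)
  case 0
  then show ?case
    by (auto intro: continuous_at_imp_continuous_on differentiable_imp_continuous_within)
next
  case (Suc k)
  then show ?case
    by (metis C_on.simps(2))
qed

lemma in_basis_differentiable:
  assumes "L differentiable (at (\<Sum>a\<in>UNIV. y $ a *\<^sub>R b a))"
  shows "in_basis b L differentiable (at y)"
    and "partial i (in_basis b L) y = in_basis b (\<lambda>u. frechet_derivative L (at u) (b i)) y"
proof -
  let ?D = "frechet_derivative L (at (\<Sum>a\<in>UNIV. y $ a *\<^sub>R b a))"
  have "((\<lambda>y. \<Sum>a\<in>UNIV. y $ a *\<^sub>R b a) has_derivative (\<lambda>h. \<Sum>a\<in>UNIV. h $ a *\<^sub>R b a)) (at y)"
    by (intro has_derivative_sum has_derivative_scaleR_left bounded_linear_imp_has_derivative bounded_linear_vec_nth)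
  moreover have "(L has_derivative ?D) (at (\<Sum>a\<in>UNIV. y $ a *\<^sub>R b a))"
    using assms frechet_derivative_works by blast
  ultimately have *: "(in_basis b L has_derivative (\<lambda>h. ?D (\<Sum>a\<in>UNIV. h $ a *\<^sub>R b a))) (at y)"
    unfolding in_basis_def[abs_def] by (rule has_derivative_compose)
  then show "in_basis b L differentiable (at y)"
    using differentiable_def by blast
  have "(\<Sum>a\<in>UNIV. axis i 1 $ a *\<^sub>R b a) = b i"
    by (simp add: axis_def if_distrib[of "\<lambda>r. r *\<^sub>R _"] cong: if_cong)
  then show "partial i (in_basis b L) y = in_basis b (\<lambda>u. frechet_derivative L (at u) (b i)) y"
    using partial_has_derivative[OF *] by (simp add: in_basis_def)
qed

definition basis_region :: "('n::finite \<Rightarrow> 'v::euclidean_space) \<Rightarrow> 'v set \<Rightarrow> (real^'n) set" where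
  "basis_region b \<omega> = {y. (\<Sum>a\<in>UNIV. y $ a *\<^sub>R b a) \<in> \<omega>}"

lemma open_basis_region: "open \<omega> \<Longrightarrow> open (basis_region b \<omega>)"
  using open_vimage[of \<omega> "\<lambda>y. \<Sum>a\<in>UNIV. y $ a *\<^sub>R b a"]
  by (simp add: basis_region_def vimage_def continuous_intros)

text \<open>A partial of \<open>in_basis b L\<close> is \<open>in_basis b\<close> of the directional
  derivative of \<open>L\<close> along \<open>b i\<close>, and that derivative is
  \<open>C_on\<close> one order lower; the induction therefore runs over all
  \<open>L\<close>.\<close>

lemma kdiff_in_basis:
  assumes "open \<omega>" "C_on k L \<omega>" "y \<in> basis_region b \<omega>"
  shows "kdiff k (in_basis b L) y"
  using assms(2,3)
proof (induction k arbitrary: L y)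
  case (Suc k)
  have ev: "\<forall>\<^sub>F z in nhds y. z \<in> basis_region b \<omega>"
    using open_basis_region[OF assms(1)] Suc.prems(2) eventually_nhds by blast
  then have "\<forall>\<^sub>F z in nhds y. kdiff k (in_basis b L) z"
    by eventually_elim (rule Suc.IH[OF C_on_SucD[OF Suc.prems(1)]])
  moreover have d: "L differentiable (at (\<Sum>a\<in>UNIV. z $ a *\<^sub>R b a))" if "z \<in> basis_region b \<omega>" for z
    using Suc.prems(1) that by (simp add: basis_region_def)
  moreover have "in_basis b L differentiable (at y)"
    using d[OF Suc.prems(2)] by (rule in_basis_differentiable)
  moreover have "kdiff k (partial i (in_basis b L)) y" for i
  proof (rule kdiff_partialI)
    show "\<forall>\<^sub>F z in nhds y. partial i (in_basis b L) z = in_basis b (\<lambda>u. frechet_derivative L (at u) (b i)) z"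
      using ev by eventually_elim (intro in_basis_differentiable d)
    show "kdiff k (in_basis b (\<lambda>u. frechet_derivative L (at u) (b i))) y"
      using Suc.prems by (intro Suc.IH) simp_all
  qed
  ultimately show ?case
    by simp
qed simp

lemma metric_in_basis:
  assumes "open \<omega>" "C_on 2 L \<omega>" "y \<in> basis_region b \<omega>"
  shows "metric (in_basis b L) y $ i $ j = hessian L (\<Sum>a\<in>UNIV. y $ a *\<^sub>R b a) (b i) (b j)"
proof -
  have C: "C_on (Suc (Suc 0)) L \<omega>"
    using assms(2) by (simp only: numeral_2_eq_2)
  have "\<forall>\<^sub>F z in nhds y. z \<in> basis_region b \<omega>"
    using open_basis_region[OF assms(1)] assms(3) eventually_nhds by blast
  then have "\<forall>\<^sub>F z in nhds y. partial j (in_basis b L) z = in_basis b (\<lambda>u. frechet_derivative L (at u) (b j)) z"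
    by eventually_elim (rule in_basis_differentiable, use C in \<open>simp add: basis_region_def\<close>)
  then have "metric (in_basis b L) y $ i $ j = partial i (in_basis b (\<lambda>u. frechet_derivative L (at u) (b j))) y"
    by (simp add: metric_def partial_cong)
  also have "\<dots> = hessian L (\<Sum>a\<in>UNIV. y $ a *\<^sub>R b a) (b i) (b j)"
    using C assms(3) by (subst in_basis_differentiable(2)) (auto simp: basis_region_def in_basis_def hessian_def)
  finally show ?thesis .
qed

section \<open>The spray of a Lagrangian written in a moving frame\<close>

text \<open>The cancellation of a vierbein against its dual, for an arbitrary indexed family
  \<open>X\<close>.\<close>

lemma contract:
  fixes P Q :: "real^'n^'n"
  assumes "P ** Q = mat 1"
  shows "(\<Sum>s\<in>UNIV. P $ r $ s * (\<Sum>a\<in>UNIV. Q $ s $ a * X a)) = X r"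
proof -
  have "P *v (Q *v (\<chi> a. X a)) = (\<chi> a. X a)"
    by (simp add: matrix_vector_mul_assoc assms)
  from arg_cong[OF this, of "\<lambda>v. v $ r"] show ?thesis
    by (simp add: matrix_vector_mult_def)
qed

lemma contract_transpose:
  fixes P Q :: "real^'n^'n"
  assumes "P ** Q = mat 1"
  shows "(\<Sum>s\<in>UNIV. Q $ s $ r * (\<Sum>a\<in>UNIV. P $ a $ s * X a)) = X r"
proof -
  have "transpose Q ** transpose P = mat 1"
    by (simp add: matrix_transpose_mul[symmetric] assms transpose_mat)
  from contract[OF this, of r X] show ?thesis
    by (simp add: transpose_def)
qed

text \<open>The chain rule nests the sums in the order of differentiation. Reversed, the outermost
  sum meets the innermost contraction with the vierbein, and the three contractions cancel one after
  another.\<close>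

lemma sum3_reverse:
  fixes p :: "'a \<Rightarrow> real"
  shows "(\<Sum>a\<in>I. p a * (\<Sum>b\<in>J. q b * (\<Sum>c\<in>K. r c * T a b c)))
    = (\<Sum>c\<in>K. r c * (\<Sum>b\<in>J. q b * (\<Sum>a\<in>I. p a * T a b c)))"
proof -
  have "(\<Sum>a\<in>I. \<Sum>b\<in>J. \<Sum>c\<in>K. p a * (q b * (r c * T a b c)))
      = (\<Sum>b\<in>J. \<Sum>c\<in>K. \<Sum>a\<in>I. p a * (q b * (r c * T a b c)))"
    by (subst sum.swap) (rule sum.cong[OF refl sum.swap])
  also have "\<dots> = (\<Sum>c\<in>K. \<Sum>b\<in>J. \<Sum>a\<in>I. r c * (q b * (p a * T a b c)))"
    by (subst sum.swap) (simp add: mult.left_commute)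
  finally show ?thesis
    by (simp only: sum_distrib_left)
qed

lemma sum4_rotate:
  "(\<Sum>d\<in>D. \<Sum>a\<in>I. \<Sum>b\<in>J. \<Sum>c\<in>K. G d a b c) = (\<Sum>a\<in>I. \<Sum>b\<in>J. \<Sum>c\<in>K. \<Sum>d\<in>D. G d a b c)"
  by (subst sum.swap, rule sum.cong[OF refl], subst sum.swap, rule sum.cong[OF refl], rule sum.swap)

lemma foldr_partial_double_sum:
  fixes c :: "'n::finite \<Rightarrow> 'n \<Rightarrow> real"
  assumes "\<And>i m. kdiff (length is) (H i m) y"
  shows "foldr partial is (\<lambda>z. \<Sum>i\<in>UNIV. \<Sum>m\<in>UNIV. c i m * H i m z) y
    = (\<Sum>i\<in>UNIV. \<Sum>m\<in>UNIV. c i m * foldr partial is (H i m) y)"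
  by (simp add: foldr_partial_sum foldr_partial_cmult kdiff_sum kdiff_mult kdiff_const assms)

lemma foldr_partial_triple_sum:
  fixes c :: "'n::finite \<Rightarrow> 'n \<Rightarrow> 'n \<Rightarrow> real"
  assumes "\<And>i m n. kdiff (length is) (H i m n) y"
  shows "foldr partial is (\<lambda>z. \<Sum>i\<in>UNIV. \<Sum>m\<in>UNIV. \<Sum>n\<in>UNIV. c i m n * H i m n z) y
    = (\<Sum>i\<in>UNIV. \<Sum>m\<in>UNIV. \<Sum>n\<in>UNIV. c i m n * foldr partial is (H i m n) y)"
  by (simp add: foldr_partial_sum foldr_partial_cmult kdiff_sum kdiff_mult kdiff_const assms)

lemma metric_symmetric:
  assumes "kdiff (Suc (Suc 0)) f z"
  shows "metric f z $ a $ b = metric f z $ b $ a"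
  using partial_commute[OF assms] by (simp add: metric_def)

lemma inv_metric_symmetric:
  assumes "kdiff (Suc (Suc 0)) f z" and "det (metric f z) \<noteq> 0"
  shows "inv_metric f z $ a $ b = inv_metric f z $ b $ a"
proof -
  have "transpose (metric f z) = metric f z"
    using metric_symmetric[OF assms(1)] by (simp add: transpose_def vec_eq_iff)
  then have "transpose (matrix_inv (metric f z)) ** metric f z = transpose (metric f z ** matrix_inv (metric f z))"
    by (simp add: matrix_transpose_mul)
  then have "transpose (matrix_inv (metric f z)) ** metric f z = mat 1"
    by (simp add: matrix_inv(1)[OF assms(2)] transpose_mat)
  then have "matrix_inv (metric f z) = transpose (matrix_inv (metric f z))"
    by (rule matrix_inv_unique)
  from arg_cong[OF this, of "\<lambda>M. M $ a $ b"] show ?thesis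
    by (simp add: inv_metric_def transpose_def)
qed

text \<open>\<open>B z $ a $ \<mu>\<close> stands for \<open>e\<^sup>a\<^sub>\<mu>(z)\<close> and \<open>E $ \<mu> $ a\<close> for \<open>e\<^sup>\<mu>\<^sub>a(x)\<close>; \<open>dB \<nu> a \<mu>\<close> is \<open>\<partial>\<^sub>\<nu>e\<^sup>a\<^sub>\<mu>(x)\<close>.
  In terms of them \<open>c\<^sup>i\<^sub>m\<^sub>n = de\<^sup>i(e\<^sub>n, e\<^sub>m)\<close>.\<close>

locale moving_frame =
  fixes B :: "real^'n::finite \<Rightarrow> real^'n^'n"
    and f :: "real^'n \<Rightarrow> real"
    and F :: "real^'n \<Rightarrow> real^'n \<Rightarrow> real"
    and S R :: "(real^'n) set"
    and x :: "real^'n"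
  assumes open_S: "open S" and x_in_S: "x \<in> S"
    and B_differentiable: "\<And>a \<mu>. (\<lambda>z. B z $ a $ \<mu>) differentiable (at x)"
    and B_nonsingular: "det (B x) \<noteq> 0"
    and open_R: "open R"
    and F_eq: "\<And>z y. z \<in> S \<Longrightarrow> B z *v y \<in> R \<Longrightarrow> F z y = f (B z *v y)"
    and f_kdiff: "\<And>z. z \<in> R \<Longrightarrow> kdiff 4 f z"
    and metric_nonsingular: "\<And>z. z \<in> R \<Longrightarrow> det (metric f z) \<noteq> 0"
begin

definition E :: "real^'n^'n" where "E = matrix_inv (B x)"

definition dB :: "'n \<Rightarrow> 'n \<Rightarrow> 'n \<Rightarrow> real" where
  "dB \<nu> a \<mu> = partial \<nu> (\<lambda>z. B z $ a $ \<mu>) x"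

definition c :: "'n \<Rightarrow> 'n \<Rightarrow> 'n \<Rightarrow> real" where
  "c i m n = (\<Sum>\<sigma>\<in>UNIV. \<Sum>\<rho>\<in>UNIV. (dB \<rho> i \<sigma> - dB \<sigma> i \<rho>) * (E $ \<sigma> $ m * E $ \<rho> $ n))"

text \<open>The function g^{rm} y_i y^n of the theorem, with y_i =
  \<open>partial i f\<close>.\<close>

definition H :: "'n \<Rightarrow> 'n \<Rightarrow> 'n \<Rightarrow> 'n \<Rightarrow> real^'n \<Rightarrow> real" where
  "H r i m n z = inv_metric f z $ r $ m * partial i f z * z $ n"

definition K :: "'n \<Rightarrow> real^'n \<Rightarrow> real" where
  "K r z = (\<Sum>i\<in>UNIV. \<Sum>m\<in>UNIV. \<Sum>n\<in>UNIV. c i m n * H r i m n z)"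

text \<open>Here \<open>y\<close> has coordinate components, whereas the argument of
  \<open>K\<close> has frame components; hence the evaluation of \<open>K\<close> at
  \<open>B x *v y\<close> below.\<close>

definition Q :: "'n \<Rightarrow> real^'n \<Rightarrow> real" where
  "Q r y = (\<Sum>\<rho>\<in>UNIV. \<Sum>\<nu>\<in>UNIV. dB \<rho> r \<nu> * (y $ \<nu> * y $ \<rho>))"

lemma BE: "B x ** E = mat 1" and EB: "E ** B x = mat 1"
  using matrix_inv[OF B_nonsingular] by (simp_all add: E_def)

lemma f_kdiff_le: "z \<in> R \<Longrightarrow> k \<le> 4 \<Longrightarrow> kdiff k f z"
  using f_kdiff kdiff_mono by blast

lemma f_differentiable: "z \<in> R \<Longrightarrow> f differentiable (at z)"
  using kdiff_differentiable[OF f_kdiff] by simp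

lemma partial_f_differentiable: "z \<in> R \<Longrightarrow> partial i f differentiable (at z)"
  using f_kdiff_le[of z "Suc (Suc 0)"] by simp

lemma metric_sym: "z \<in> R \<Longrightarrow> metric f z $ a $ b = metric f z $ b $ a"
  by (rule metric_symmetric) (simp add: f_kdiff_le del: kdiff.simps)

lemma inv_metric_sym: "z \<in> R \<Longrightarrow> inv_metric f z $ a $ b = inv_metric f z $ b $ a"
  by (rule inv_metric_symmetric) (simp_all add: f_kdiff_le metric_nonsingular del: kdiff.simps)

lemma eventually_in_R: "z \<in> R \<Longrightarrow> \<forall>\<^sub>F z in nhds z. z \<in> R"
  using open_R eventually_nhds by blast

section \<open>Base and fibre derivatives of the Lagrangian, and the spray\<close>

lemma frame_apply_differentiable: "(\<lambda>z. (B z *v y) $ b) differentiable (at x)"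
  by (simp add: matrix_vector_mult_def differentiable_mult B_differentiable)

lemma partial_frame_apply: "partial \<rho> (\<lambda>z. (B z *v y) $ b) x = (\<Sum>\<nu>\<in>UNIV. dB \<rho> b \<nu> * y $ \<nu>)"
  by (simp add: matrix_vector_mult_def partial_sum partial_mult differentiable_mult B_differentiable dB_def)

lemma eventually_base:
  assumes "B x *v y \<in> R"
  shows "\<forall>\<^sub>F z in nhds x. z \<in> S \<and> B z *v y \<in> R"
proof -
  have "(\<lambda>z. B z *v y) differentiable (at x)"
    by (rule differentiable_vec) (rule frame_apply_differentiable)
  then have "isCont (\<lambda>z. B z *v y) x"
    by (rule differentiable_imp_continuous_within)
  then have "filterlim (\<lambda>z. B z *v y) (nhds (B x *v y)) (nhds x)"
    by (simp add: isCont_def tendsto_at_iff_tendsto_nhds[of "\<lambda>z. B z *v y"])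
  then have "\<forall>\<^sub>F z in nhds x. B z *v y \<in> R"
    using eventually_in_R[OF assms] eventually_compose_filterlim by blast
  moreover have "\<forall>\<^sub>F z in nhds x. z \<in> S"
    using open_S x_in_S eventually_nhds by blast
  ultimately show ?thesis
    by eventually_elim simp
qed

lemma eventually_F_fibre:
  assumes "z \<in> S" "B z *v y \<in> R"
  shows "\<forall>\<^sub>F y in nhds y. F z y = f (B z *v y)"
  using eventually_linear[OF eventually_in_R[OF assms(2)]]
  by eventually_elim (rule F_eq[OF assms(1)])

lemma partial_F_fibre:
  assumes "z \<in> S" "B z *v y \<in> R"
  shows "partial \<sigma> (F z) y = (\<Sum>a\<in>UNIV. B z $ a $ \<sigma> * partial a f (B z *v y))"
  using partial_cong[OF eventually_F_fibre[OF assms]] partial_linear[OF f_differentiable[OF assms(2)]]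
  by simp

lemma partial_F_base:
  assumes "B x *v y \<in> R"
  shows "partial \<sigma> (\<lambda>z. F z y) x
    = (\<Sum>a\<in>UNIV. partial a f (B x *v y) * (\<Sum>\<nu>\<in>UNIV. dB \<sigma> a \<nu> * y $ \<nu>))"
proof -
  have "\<forall>\<^sub>F z in nhds x. F z y = f (B z *v y)"
    using eventually_base[OF assms] by eventually_elim (simp add: F_eq)
  from partial_cong[OF this] show ?thesis
    using partial_chain[OF f_differentiable[OF assms] frame_apply_differentiable]
    by (simp add: partial_frame_apply)
qed

text \<open>Two contributions of the product rule: the derivative of the vierbein factor in front,
  and that of the argument of y_a, which brings in the metric.\<close>

lemma partial_base_partial_fibre_F:
  assumes y: "B x *v y \<in> R"
  shows "partial \<rho> (\<lambda>z. partial \<sigma> (F z) y) x = (\<Sum>a\<in>UNIV. dB \<rho> a \<sigma> * partial a f (B x *v y) +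
      B x $ a $ \<sigma> * (\<Sum>b\<in>UNIV. metric f (B x *v y) $ b $ a * (\<Sum>\<nu>\<in>UNIV. dB \<rho> b \<nu> * y $ \<nu>)))"
proof -
  have "\<forall>\<^sub>F z in nhds x. partial \<sigma> (F z) y = (\<Sum>a\<in>UNIV. B z $ a $ \<sigma> * partial a f (B z *v y))"
    using eventually_base[OF y] by eventually_elim (simp add: partial_F_fibre)
  then have "partial \<rho> (\<lambda>z. partial \<sigma> (F z) y) x
      = partial \<rho> (\<lambda>z. \<Sum>a\<in>UNIV. B z $ a $ \<sigma> * partial a f (B z *v y)) x"
    by (rule partial_cong)
  moreover have "(\<lambda>z. partial a f (B z *v y)) differentiable (at x)" for a
    by (rule differentiable_compose[of "partial a f"])
      (auto intro!: differentiable_vec frame_apply_differentiable partial_f_differentiable y)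
  ultimately show ?thesis
    using partial_chain[OF partial_f_differentiable[OF y] frame_apply_differentiable]
    by (simp add: partial_sum partial_mult B_differentiable differentiable_mult dB_def[symmetric]
        partial_frame_apply metric_def)
qed

lemma metric_F:
  assumes y: "B x *v y \<in> R"
  shows "metric (F x) y = transpose (B x) ** metric f (B x *v y) ** B x"
proof -
  have "metric (F x) y $ \<alpha> $ \<beta> = (\<Sum>b\<in>UNIV. \<Sum>a\<in>UNIV. B x $ a $ \<alpha> * metric f (B x *v y) $ a $ b * B x $ b $ \<beta>)" for \<alpha> \<beta>
  proof -
    have "\<forall>\<^sub>F y in nhds y. partial \<beta> (F x) y = (\<lambda>w. \<Sum>b\<in>UNIV. B x $ b $ \<beta> * partial b f w) (B x *v y)"
      using eventually_linear[OF eventually_in_R[OF y]]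
      by eventually_elim (simp add: partial_F_fibre x_in_S)
    from partial_cong[OF this]
    have "metric (F x) y $ \<alpha> $ \<beta> = partial \<alpha> (\<lambda>y. (\<lambda>w. \<Sum>b\<in>UNIV. B x $ b $ \<beta> * partial b f w) (B x *v y)) y"
      by (simp add: metric_def)
    also have "\<dots> = (\<Sum>a\<in>UNIV. B x $ a $ \<alpha> * (\<Sum>b\<in>UNIV. B x $ b $ \<beta> * partial a (partial b f) (B x *v y)))"
      by (subst partial_linear)
         (simp_all add: partial_f_differentiable y partial_sum partial_cmult differentiable_mult)
    finally show ?thesis
      by (subst sum.swap) (simp add: sum_distrib_left metric_def mult_ac)
  qed
  then show ?thesis
    by (simp add: vec_eq_iff matrix_matrix_mult_def transpose_def sum_distrib_right)
qed

text \<open>By \<open>metric_F\<close> the coordinate metric is congruent to the frame metric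
  through \<open>B x\<close>, so its inverse is E g^-1 E^T.\<close>

lemma inv_metric_F:
  assumes y: "B x *v y \<in> R"
  shows "inv_metric (F x) y $ \<mu> $ \<sigma>
    = (\<Sum>r\<in>UNIV. E $ \<mu> $ r * (\<Sum>m\<in>UNIV. inv_metric f (B x *v y) $ r $ m * E $ \<sigma> $ m))"
proof -
  let ?h = "metric f (B x *v y)"
  have EBT: "transpose E ** transpose (B x) = mat 1"
    by (simp add: matrix_transpose_mul[symmetric] BE transpose_mat)
  have "(E ** (matrix_inv ?h ** transpose E)) ** metric (F x) y
      = E ** (matrix_inv ?h ** ((transpose E ** transpose (B x)) ** (?h ** B x)))"
    by (simp add: metric_F[OF y] matrix_mul_assoc)
  also have "\<dots> = E ** ((matrix_inv ?h ** ?h) ** B x)"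
    by (simp only: EBT matrix_mul_lid matrix_mul_assoc)
  also have "\<dots> = mat 1"
    by (simp add: matrix_inv metric_nonsingular y matrix_mul_lid EB)
  finally have "inv_metric (F x) y = E ** (matrix_inv ?h ** transpose E)"
    unfolding inv_metric_def by (rule matrix_inv_unique)
  then show ?thesis
    by (simp add: inv_metric_def matrix_matrix_mult_def transpose_def)
qed

text \<open>\<open>V\<close> is the bracket in the spray. An x-derivative falling on the argument of
  \<open>f\<close> gives the metric times the quadratic vector \<open>D\<close>; the inverse metric
  undoes it and leaves \<open>Q\<close>. One falling on the vierbein factor in front combines with
  the subtracted base derivative into the antisymmetrised \<open>dB\<close>, which becomes
  \<open>c\<close> once two factors \<open>E\<close> are attached.\<close>

lemma spray_eq:
  assumes y: "B x *v y \<in> R"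
  shows "spray F x \<mu> y = (\<Sum>r\<in>UNIV. E $ \<mu> $ r * (1/2 * Q r y + 1/2 * K r (B x *v y)))"
proof -
  define w where "w = B x *v y"
  define D where "D b = (\<Sum>\<rho>\<in>UNIV. \<Sum>\<nu>\<in>UNIV. dB \<rho> b \<nu> * y $ \<nu> * y $ \<rho>)" for b
  define V where "V \<sigma> = (\<Sum>\<rho>\<in>UNIV. partial \<rho> (\<lambda>z. partial \<sigma> (F z) y) x * y $ \<rho>) - partial \<sigma> (\<lambda>z. F z y) x" for \<sigma>
  have w: "w \<in> R"
    using y by (simp add: w_def)
  \<comment> \<open>Writing \<open>y\<close> in frame components supplies the second
    \<open>E\<close> in \<open>c\<close>; the first comes from the inverse metric.\<close>
  have yE: "y $ \<rho> = (\<Sum>n\<in>UNIV. E $ \<rho> $ n * w $ n)" for \<rho>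
    using contract[OF EB, of \<rho> "\<lambda>a. y $ a"] by (simp add: w_def matrix_vector_mult_def)
  have V: "V \<sigma> = (\<Sum>a\<in>UNIV. B x $ a $ \<sigma> * (\<Sum>b\<in>UNIV. metric f w $ b $ a * D b)) +
      (\<Sum>a\<in>UNIV. partial a f w * (\<Sum>\<rho>\<in>UNIV. (dB \<rho> a \<sigma> - dB \<sigma> a \<rho>) * y $ \<rho>))" for \<sigma>
  proof -
    have "(\<Sum>\<rho>\<in>UNIV. (\<Sum>a\<in>UNIV. B x $ a $ \<sigma> * (\<Sum>b\<in>UNIV. metric f w $ b $ a * (\<Sum>\<nu>\<in>UNIV. dB \<rho> b \<nu> * y $ \<nu>))) * y $ \<rho>)
        = (\<Sum>a\<in>UNIV. B x $ a $ \<sigma> * (\<Sum>b\<in>UNIV. metric f w $ b $ a * D b))"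
    proof -
      have "(\<Sum>\<rho>\<in>UNIV. (\<Sum>a\<in>UNIV. B x $ a $ \<sigma> * (\<Sum>b\<in>UNIV. metric f w $ b $ a * (\<Sum>\<nu>\<in>UNIV. dB \<rho> b \<nu> * y $ \<nu>))) * y $ \<rho>)
        = (\<Sum>\<rho>\<in>UNIV. y $ \<rho> * (\<Sum>a\<in>UNIV. B x $ a $ \<sigma> * (\<Sum>b\<in>UNIV. metric f w $ b $ a * (\<Sum>\<nu>\<in>UNIV. dB \<rho> b \<nu> * y $ \<nu>))))"
        by (simp only: mult.commute)
      also have "\<dots> = (\<Sum>a\<in>UNIV. B x $ a $ \<sigma> * (\<Sum>b\<in>UNIV. metric f w $ b $ a * (\<Sum>\<rho>\<in>UNIV. y $ \<rho> * (\<Sum>\<nu>\<in>UNIV. dB \<rho> b \<nu> * y $ \<nu>))))"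
        unfolding sum_distrib_left[of _ _ UNIV]
        by (rule trans[OF sum.swap], rule sum.cong[OF refl], rule trans[OF sum.swap])
          (simp add: mult.left_commute)
      finally show ?thesis
        by (simp add: D_def sum_distrib_left mult_ac)
    qed
    moreover have "(\<Sum>\<rho>\<in>UNIV. (\<Sum>a\<in>UNIV. dB \<rho> a \<sigma> * partial a f w) * y $ \<rho>)
        = (\<Sum>a\<in>UNIV. partial a f w * (\<Sum>\<rho>\<in>UNIV. dB \<rho> a \<sigma> * y $ \<rho>))"
      unfolding sum_distrib_left sum_distrib_right by (subst sum.swap) (simp add: mult_ac)
    ultimately show ?thesis
      using y by (simp add: V_def partial_base_partial_fibre_F partial_F_base w_def[symmetric] sum.distrib
          left_diff_distrib right_diff_distrib distrib_right sum_subtractf)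
  qed
  have EV: "(\<Sum>\<sigma>\<in>UNIV. E $ \<sigma> $ m * V \<sigma>)
      = (\<Sum>b\<in>UNIV. metric f w $ m $ b * D b) + (\<Sum>i\<in>UNIV. \<Sum>n\<in>UNIV. c i m n * (partial i f w * w $ n))" for m
  proof -
    have "(\<Sum>\<sigma>\<in>UNIV. E $ \<sigma> $ m * (\<Sum>a\<in>UNIV. partial a f w * (\<Sum>\<rho>\<in>UNIV. (dB \<rho> a \<sigma> - dB \<sigma> a \<rho>) * y $ \<rho>)))
        = (\<Sum>\<sigma>\<in>UNIV. E $ \<sigma> $ m * (\<Sum>a\<in>UNIV. partial a f w * (\<Sum>n\<in>UNIV. w $ n * (\<Sum>\<rho>\<in>UNIV. (dB \<rho> a \<sigma> - dB \<sigma> a \<rho>) * E $ \<rho> $ n))))"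
    proof -
      have "(\<Sum>\<rho>\<in>UNIV. (dB \<rho> a \<sigma> - dB \<sigma> a \<rho>) * y $ \<rho>)
          = (\<Sum>n\<in>UNIV. w $ n * (\<Sum>\<rho>\<in>UNIV. (dB \<rho> a \<sigma> - dB \<sigma> a \<rho>) * E $ \<rho> $ n))" for a \<sigma>
        unfolding yE sum_distrib_left by (subst sum.swap) (simp add: mult_ac)
      then show ?thesis
        by simp
    qed
    also have "\<dots> = (\<Sum>i\<in>UNIV. partial i f w * (\<Sum>n\<in>UNIV. w $ n * (\<Sum>\<sigma>\<in>UNIV. E $ \<sigma> $ m * (\<Sum>\<rho>\<in>UNIV. (dB \<rho> i \<sigma> - dB \<sigma> i \<rho>) * E $ \<rho> $ n))))"
      unfolding sum_distrib_left[of _ _ UNIV]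
      by (rule trans[OF sum.swap], rule sum.cong[OF refl], rule trans[OF sum.swap])
          (simp add: mult.left_commute)
    also have "\<dots> = (\<Sum>i\<in>UNIV. \<Sum>n\<in>UNIV. c i m n * (partial i f w * w $ n))"
      by (simp add: c_def sum_distrib_left sum_distrib_right mult_ac)
    finally show ?thesis
      by (simp add: V distrib_left sum.distrib contract_transpose[OF BE] metric_sym[OF w, of m])
  qed
  have "(\<Sum>m\<in>UNIV. inv_metric f w $ r $ m * (\<Sum>\<sigma>\<in>UNIV. E $ \<sigma> $ m * V \<sigma>)) = Q r y + K r w" for r
  proof -
    have "inv_metric f w ** metric f w = mat 1"
      unfolding inv_metric_def by (rule matrix_inv(2)[OF metric_nonsingular[OF w]])
    then have "(\<Sum>m\<in>UNIV. inv_metric f w $ r $ m * (\<Sum>b\<in>UNIV. metric f w $ m $ b * D b)) = Q r y"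
      by (simp add: contract Q_def D_def mult.assoc)
    moreover have "(\<Sum>m\<in>UNIV. inv_metric f w $ r $ m * (\<Sum>i\<in>UNIV. \<Sum>n\<in>UNIV. c i m n * (partial i f w * w $ n))) = K r w"
      unfolding sum_distrib_left by (subst sum.swap) (simp add: K_def H_def mult_ac)
    ultimately show ?thesis
      by (simp add: EV distrib_left sum.distrib)
  qed
  moreover have "spray F x \<mu> y
      = 1/2 * (\<Sum>r\<in>UNIV. E $ \<mu> $ r * (\<Sum>m\<in>UNIV. inv_metric f w $ r $ m * (\<Sum>\<sigma>\<in>UNIV. E $ \<sigma> $ m * V \<sigma>)))"
  proof -
    have "spray F x \<mu> y = 1/2 * (\<Sum>\<sigma>\<in>UNIV. V \<sigma> * (\<Sum>r\<in>UNIV. E $ \<mu> $ r * (\<Sum>m\<in>UNIV. inv_metric f w $ r $ m * E $ \<sigma> $ m)))"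
      using inv_metric_F[OF y] by (simp add: spray_def V_def w_def mult.commute)
    also have "(\<Sum>\<sigma>\<in>UNIV. V \<sigma> * (\<Sum>r\<in>UNIV. E $ \<mu> $ r * (\<Sum>m\<in>UNIV. inv_metric f w $ r $ m * E $ \<sigma> $ m)))
        = (\<Sum>r\<in>UNIV. E $ \<mu> $ r * (\<Sum>m\<in>UNIV. inv_metric f w $ r $ m * (\<Sum>\<sigma>\<in>UNIV. E $ \<sigma> $ m * V \<sigma>)))"
      unfolding sum_distrib_left
      by (rule trans[OF sum.swap], rule sum.cong[OF refl], rule trans[OF sum.swap])
          (simp add: mult_ac)
    finally show ?thesis .
  qed
  ultimately show ?thesis
    by (simp add: sum_distrib_left distrib_left w_def mult_ac)
qed

end

section \<open>Commutation coefficients and the third vertical derivative of the spray\<close>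

context moving_frame
begin

text \<open>Each half of the bracket differentiates an inverse matrix. The minus sign of that rule
  exchanges the two halves, whence the order of \<open>m\<close> and \<open>n\<close> in
  \<open>c\<close>.\<close>

lemma lie_bracket_frame:
  "lie_bracket (\<lambda>z. \<chi> \<mu>. matrix_inv (B z) $ \<mu> $ m) (\<lambda>z. \<chi> \<mu>. matrix_inv (B z) $ \<mu> $ n) x $ \<mu>
    = (\<Sum>a\<in>UNIV. E $ \<mu> $ a * c a m n)"
proof -
  have dE: "partial \<nu> (\<lambda>z. matrix_inv (B z) $ \<mu> $ k) x
      = - (\<Sum>a\<in>UNIV. E $ \<mu> $ a * (\<Sum>b\<in>UNIV. dB \<nu> a b * E $ b $ k))" for \<nu> k
    using partial_matrix_inv[OF B_differentiable B_nonsingular]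
    by (simp add: E_def dB_def sum_distrib_left mult.assoc)
  have half: "(\<Sum>\<nu>\<in>UNIV. E $ \<nu> $ k * (\<Sum>a\<in>UNIV. E $ \<mu> $ a * (\<Sum>b\<in>UNIV. dB \<nu> a b * E $ b $ l)))
      = (\<Sum>a\<in>UNIV. E $ \<mu> $ a * (\<Sum>\<nu>\<in>UNIV. \<Sum>b\<in>UNIV. dB \<nu> a b * (E $ b $ l * E $ \<nu> $ k)))" for k l
    unfolding sum_distrib_left by (subst sum.swap) (simp add: mult_ac)
  have "c a m n = (\<Sum>\<nu>\<in>UNIV. \<Sum>b\<in>UNIV. dB \<nu> a b * (E $ b $ m * E $ \<nu> $ n))
      - (\<Sum>\<nu>\<in>UNIV. \<Sum>b\<in>UNIV. dB \<nu> a b * (E $ b $ n * E $ \<nu> $ m))" for a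
  proof -
    have "c a m n = (\<Sum>\<sigma>\<in>UNIV. \<Sum>\<rho>\<in>UNIV. dB \<rho> a \<sigma> * (E $ \<sigma> $ m * E $ \<rho> $ n))
      - (\<Sum>\<sigma>\<in>UNIV. \<Sum>\<rho>\<in>UNIV. dB \<sigma> a \<rho> * (E $ \<sigma> $ m * E $ \<rho> $ n))"
      by (simp add: c_def left_diff_distrib sum_subtractf)
    then show ?thesis
      by (subst (asm) sum.swap) (simp add: mult.commute[of "E $ _ $ m"])
  qed
  then show ?thesis
    by (simp add: lie_bracket_def dE E_def[symmetric] sum_subtractf sum_negf half right_diff_distrib)
qed

text \<open>The frame is invertible, so coefficients with respect to it are determined. This
  identifies any given commutation coefficients with \<open>c\<close>.\<close>

lemma commutation_coeff_unique:
  assumes "\<And>\<mu>. (\<Sum>a\<in>UNIV. E $ \<mu> $ a * k a) = (\<Sum>a\<in>UNIV. E $ \<mu> $ a * l a)"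
  shows "k a = l a"
  using contract[OF BE, of a k] contract[OF BE, of a l] assms by simp

lemma c_antisym: "c i n m = - c i m n"
proof -
  have "c i n m = (\<Sum>\<sigma>\<in>UNIV. \<Sum>\<rho>\<in>UNIV. (dB \<sigma> i \<rho> - dB \<rho> i \<sigma>) * (E $ \<rho> $ n * E $ \<sigma> $ m))"
    unfolding c_def by (rule sum.swap)
  then show ?thesis
    by (simp add: c_def sum_negf[symmetric] algebra_simps)
qed

lemma kdiff_metric:
  assumes "kdiff (Suc (Suc k)) f w"
  shows "kdiff k (\<lambda>z. metric f z $ a $ b) w"
  using assms by (simp add: metric_def)

lemma kdiff_inv_metric:
  assumes "kdiff (Suc (Suc k)) f w" "w \<in> R"
  shows "kdiff k (\<lambda>z. inv_metric f z $ a $ b) w"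
  unfolding inv_metric_def
  by (rule kdiff_matrix_inv[OF kdiff_metric[OF assms(1)] metric_nonsingular[OF assms(2)]])

text \<open>The metric costs two levels; three derivatives of \<open>H\<close> thus require level 5
  of \<open>f\<close>.\<close>

lemma kdiff_H:
  assumes "kdiff (Suc (Suc k)) f w" "w \<in> R"
  shows "kdiff k (H r i m n) w"
  unfolding H_def[abs_def]
  by (intro kdiff_mult kdiff_inv_metric kdiff_component assms kdiff_SucD[OF kdiff_partial[OF assms(1)]])

lemma kdiff_K:
  assumes "kdiff (Suc (Suc k)) f w" "w \<in> R"
  shows "kdiff k (K r) w"
  unfolding K_def[abs_def] by (intro kdiff_sum kdiff_mult kdiff_const kdiff_H assms finite)

lemma kdiff_Q: "kdiff k (Q r) y"
  unfolding Q_def[abs_def] by (intro kdiff_sum kdiff_mult kdiff_const kdiff_component finite)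

lemma partial3_Q: "partial \<alpha> (partial \<beta> (partial \<gamma> (Q r))) y = 0"
  using foldr_partial_double_sum[of "[\<alpha>, \<beta>, \<gamma>]" "\<lambda>\<rho> \<nu> y. y $ \<nu> * y $ \<rho>" y "\<lambda>\<rho>. dB \<rho> r",
      OF kdiff_mult[OF kdiff_component kdiff_component]]
  by (simp add: Q_def[abs_def] partial_partial_partial_component_mult)

lemma berwald_eq:
  assumes y: "B x *v y \<in> R" and f5: "kdiff 5 f (B x *v y)"
  shows "berwald F x y \<rho> \<alpha> \<beta> \<gamma> = (\<Sum>s\<in>UNIV. E $ \<rho> $ s * (1/2 * (\<Sum>c\<in>UNIV. B x $ c $ \<gamma> *
    (\<Sum>b\<in>UNIV. B x $ b $ \<beta> * (\<Sum>a\<in>UNIV. B x $ a $ \<alpha> *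
       partial a (partial b (partial c (K s))) (B x *v y))))))"
proof -
  let ?is = "[\<alpha>, \<beta>, \<gamma>]"
  have "(5::nat) = Suc (Suc 3)"
    by simp
  then have "kdiff (Suc (Suc 3)) f (B x *v y)"
    using f5 by (simp only:)
  then have K3: "kdiff 3 (K s) (B x *v y)" for s
    using y by (rule kdiff_K)
  have KB: "kdiff (length ?is) (\<lambda>y. K s (B x *v y)) y" for s
    using kdiff_linear[OF K3] by (simp only: list.size numeral_3_eq_3 add_Suc_right add_0_right)
  have Qh: "kdiff (length ?is) (\<lambda>y. 1/2 * Q s y) y" and Kh: "kdiff (length ?is) (\<lambda>y. 1/2 * K s (B x *v y)) y" for s
    by (intro kdiff_mult kdiff_const kdiff_Q KB)+
  have "\<forall>\<^sub>F y in nhds y. spray F x \<rho> y = (\<Sum>r\<in>UNIV. E $ \<rho> $ r * (1/2 * Q r y + 1/2 * K r (B x *v y)))"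
    using eventually_linear[OF eventually_in_R[OF y]] by eventually_elim (rule spray_eq)
  then have "foldr partial ?is (spray F x \<rho>) y
      = foldr partial ?is (\<lambda>y. \<Sum>r\<in>UNIV. E $ \<rho> $ r * (1/2 * Q r y + 1/2 * K r (B x *v y))) y"
    by (rule foldr_partial_cong)
  also have "\<dots> = (\<Sum>r\<in>UNIV. E $ \<rho> $ r * foldr partial ?is (\<lambda>y. 1/2 * Q r y + 1/2 * K r (B x *v y)) y)"
    by (rule foldr_partial_sum_cmult) (rule kdiff_add[OF Qh Kh])
  also have "\<dots> = (\<Sum>r\<in>UNIV. E $ \<rho> $ r * (1/2 * foldr partial ?is (Q r) y + 1/2 * foldr partial ?is (\<lambda>y. K r (B x *v y)) y))"
    unfolding foldr_partial_add[OF Qh Kh] foldr_partial_cmult[OF kdiff_Q] foldr_partial_cmult[OF KB] ..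
  finally show ?thesis
    by (simp add: berwald_def partial3_Q trans[OF partial3_linear[OF K3] sum3_reverse])
qed

text \<open>All vierbein factors cancel: the dual vierbein against the \<open>E\<close> in front of
  the spray, and the three \<open>E\<close> of the lower indices against the three
  \<open>B x\<close> of the chain rule.\<close>

lemma berwald_frame_eq:
  assumes y: "B x *v y \<in> R" and f5: "kdiff 5 f (B x *v y)"
    and e: "\<And>a \<mu>. e a x $ \<mu> = E $ \<mu> $ a" and dual: "dual_vierbein e x = B x"
  shows "2 * berwald_frame F e x y r a b d = partial a (partial b (partial d (K r))) (B x *v y)"
proof -
  let ?T = "\<lambda>s a b c. partial a (partial b (partial c (K s))) (B x *v y)"
  define P where "P s \<alpha> \<beta> \<gamma> = (\<Sum>c\<in>UNIV. B x $ c $ \<gamma> *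
    (\<Sum>b\<in>UNIV. B x $ b $ \<beta> * (\<Sum>a\<in>UNIV. B x $ a $ \<alpha> * ?T s a b c)))" for s \<alpha> \<beta> \<gamma>
  \<comment> \<open>The sum over the upper index goes innermost, where it meets the expansion of the
    spray in the frame.\<close>
  have "berwald_frame F e x y r a b d = (\<Sum>\<alpha>\<in>UNIV. \<Sum>\<beta>\<in>UNIV. \<Sum>\<gamma>\<in>UNIV. \<Sum>\<rho>\<in>UNIV.
      berwald F x y \<rho> \<alpha> \<beta> \<gamma> * B x $ r $ \<rho> * E $ \<alpha> $ a * E $ \<beta> $ b * E $ \<gamma> $ d)"
    unfolding berwald_frame_def dual e by (rule sum4_rotate)
  also have "\<dots> = (\<Sum>\<alpha>\<in>UNIV. \<Sum>\<beta>\<in>UNIV. \<Sum>\<gamma>\<in>UNIV. E $ \<alpha> $ a * (E $ \<beta> $ b * (E $ \<gamma> $ d *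
      (\<Sum>\<rho>\<in>UNIV. B x $ r $ \<rho> * (\<Sum>s\<in>UNIV. E $ \<rho> $ s * (1/2 * P s \<alpha> \<beta> \<gamma>))))))"
    unfolding berwald_eq[OF y f5] P_def[symmetric] by (simp add: sum_distrib_left mult_ac)
  also have "\<dots> = (\<Sum>\<alpha>\<in>UNIV. \<Sum>\<beta>\<in>UNIV. \<Sum>\<gamma>\<in>UNIV. E $ \<alpha> $ a * (E $ \<beta> $ b * (E $ \<gamma> $ d * (1/2 * P r \<alpha> \<beta> \<gamma>))))"
    unfolding contract[OF BE] ..
  also have "\<dots> = 1/2 * (\<Sum>\<alpha>\<in>UNIV. E $ \<alpha> $ a * (\<Sum>\<beta>\<in>UNIV. E $ \<beta> $ b * (\<Sum>\<gamma>\<in>UNIV. E $ \<gamma> $ d * P r \<alpha> \<beta> \<gamma>)))"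
    by (simp add: sum_distrib_left mult_ac)
  also have "\<dots> = 1/2 * ?T r a b d"
    unfolding P_def contract_transpose[OF BE] ..
  finally show ?thesis
    by simp
qed

subsection \<open>The trace of the Berwald curvature\<close>

text \<open>The rule for inverse matrices gives - g^{ra} f_{rab} g^{bm}. Third derivatives are
  totally symmetric, so g^{ra} contracts \<open>f_{bra}\<close> to 2 I_b; the factor 2 undoes the
  1/2 in \<open>cartan\<close>.\<close>

lemma partial_inv_metric_trace:
  assumes z: "z \<in> R"
  shows "(\<Sum>r\<in>UNIV. partial r (\<lambda>z. inv_metric f z $ r $ m) z) = - 2 * mean_cartan f m z"
proof -
  let ?g = "\<lambda>a b. inv_metric f z $ a $ b" and ?d = "\<lambda>a b c. partial a (partial b (partial c f)) z"
  have f3: "kdiff (Suc (Suc (Suc 0))) f z"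
    using z by (rule f_kdiff_le) simp
  have sym12: "?d a b c = ?d b a c" for a b c
    by (rule partial_commute[OF kdiff_partial[OF f3]])
  have "partial r (\<lambda>z. inv_metric f z $ r $ m) z = - (\<Sum>a\<in>UNIV. \<Sum>b\<in>UNIV. ?g r a * ?d r a b * ?g b m)" for r
  proof -
    have "partial r (\<lambda>z. metric f z $ a $ b) z = ?d r a b" for a b
      by (simp add: metric_def)
    moreover have d: "(\<lambda>z. metric f z $ a $ b) differentiable (at z)" for a b
      using kdiff_metric[OF f3] by simp
    ultimately show ?thesis
      using partial_matrix_inv[where M = "metric f", OF d metric_nonsingular[OF z]]
      by (simp add: inv_metric_def[abs_def])
  qed
  then have "(\<Sum>r\<in>UNIV. partial r (\<lambda>z. inv_metric f z $ r $ m) z)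
      = - (\<Sum>r\<in>UNIV. \<Sum>a\<in>UNIV. \<Sum>b\<in>UNIV. ?g r a * ?d r a b * ?g b m)"
    by (simp add: sum_negf)
  also have "(\<Sum>r\<in>UNIV. \<Sum>a\<in>UNIV. \<Sum>b\<in>UNIV. ?g r a * ?d r a b * ?g b m)
      = (\<Sum>b\<in>UNIV. \<Sum>r\<in>UNIV. \<Sum>a\<in>UNIV. ?g m b * (?g r a * ?d b r a))"
  proof -
    \<comment> \<open>The inner two derivatives must commute near \<open>z\<close>, since a third
      one is applied; the outer swap \<open>sym12\<close> is used at \<open>z\<close> only.\<close>
    have sym: "?d r a b = ?d b r a" for r a b
    proof -
      have "\<forall>\<^sub>F z in nhds z. partial a (partial b f) z = partial b (partial a f) z"
        using eventually_in_R[OF z] by eventually_elim (simp add: partial_commute f_kdiff_le del: kdiff.simps)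
      then have "?d r a b = ?d r b a"
        by (rule partial_cong)
      then show ?thesis
        by (simp add: sym12)
    qed
    have "(\<Sum>r\<in>UNIV. \<Sum>a\<in>UNIV. \<Sum>b\<in>UNIV. ?g r a * ?d r a b * ?g b m)
        = (\<Sum>r\<in>UNIV. \<Sum>b\<in>UNIV. \<Sum>a\<in>UNIV. ?g r a * ?d r a b * ?g b m)"
      by (rule sum.cong[OF refl sum.swap])
    also have "\<dots> = (\<Sum>b\<in>UNIV. \<Sum>r\<in>UNIV. \<Sum>a\<in>UNIV. ?g r a * ?d r a b * ?g b m)"
      by (rule sum.swap)
    finally show ?thesis
      by (simp only: sym inv_metric_sym[OF z, of _ m] mult_ac)
  qed
  also have "\<dots> = 2 * mean_cartan f m z"
    by (simp add: mean_cartan_def mean_cartan_low_def cartan_def sum_distrib_left)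
  finally show ?thesis
    by simp
qed

text \<open>The product rule on g^{rm} y_i y^n: the first factor gives -2 I^m, the second g^{mr}
  g_{ri}, a Kronecker delta, and the third selects r = n.\<close>

lemma partial_H_trace:
  assumes z: "z \<in> R"
  shows "(\<Sum>r\<in>UNIV. partial r (H r i m n) z) = - 2 * (mean_cartan f m z * partial i f z * z $ n)
    + (if m = i then 1 else 0) * z $ n + inv_metric f z $ m $ n * partial i f z"
proof -
  have g: "(\<lambda>z. inv_metric f z $ r $ m) differentiable (at z)" for r m
    using kdiff_inv_metric[of "Suc 0" z] z f_kdiff_le[OF z, of "Suc (Suc (Suc 0))"] by simp
  have H: "partial r (H r i m n) z = partial r (\<lambda>z. inv_metric f z $ r $ m) z * (partial i f z * z $ n)
      + inv_metric f z $ m $ r * metric f z $ r $ i * z $ n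
      + (if r = n then inv_metric f z $ n $ m * partial i f z else 0)" for r
    unfolding H_def[abs_def]
    by (simp add: partial_mult g partial_f_differentiable z differentiable_mult partial_component
        metric_def inv_metric_sym[OF z, of m r] distrib_right)
  have "(\<Sum>r\<in>UNIV. partial r (H r i m n) z)
      = (\<Sum>r\<in>UNIV. partial r (\<lambda>z. inv_metric f z $ r $ m) z) * (partial i f z * z $ n)
      + (\<Sum>r\<in>UNIV. inv_metric f z $ m $ r * metric f z $ r $ i) * z $ n
      + inv_metric f z $ n $ m * partial i f z"
    by (simp add: H sum.distrib sum_distrib_right)
  moreover have "(\<Sum>r\<in>UNIV. inv_metric f z $ m $ r * metric f z $ r $ i) = (if m = i then 1 else 0)"
    using arg_cong[OF matrix_inv(2)[OF metric_nonsingular[OF z]], of "\<lambda>M. M $ m $ i"]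
    by (simp add: inv_metric_def matrix_matrix_mult_def mat_def)
  ultimately show ?thesis
    by (simp add: partial_inv_metric_trace[OF z] inv_metric_sym[OF z, of n m])
qed

definition I_term :: "'n \<Rightarrow> 'n \<Rightarrow> 'n \<Rightarrow> real^'n \<Rightarrow> real" where
  "I_term i m n z = mean_cartan f m z * partial i f z * z $ n"

text \<open>The other terms of the product rule do not survive two more derivatives: one is linear, the
  other pairs the symmetric \<open>g\<^sup>m\<^sup>n\<close> with the antisymmetric \<open>c\<^sup>i\<^sub>m\<^sub>n\<close>.\<close>

lemma partial_K_trace:
  assumes z: "z \<in> R"
  shows "(\<Sum>r\<in>UNIV. partial r (K r) z) = - 2 * (\<Sum>i\<in>UNIV. \<Sum>m\<in>UNIV. \<Sum>n\<in>UNIV. c i m n * I_term i m n z)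
    + (\<Sum>n\<in>UNIV. (\<Sum>i\<in>UNIV. c i i n) * z $ n)"
proof -
  have H1: "kdiff (length [r]) (H r i m n) z" for r i m n
    using kdiff_H[of "Suc 0" z] z f_kdiff_le[OF z, of "Suc (Suc (Suc 0))"] by simp
  have "partial r (K r) z = (\<Sum>i\<in>UNIV. \<Sum>m\<in>UNIV. \<Sum>n\<in>UNIV. c i m n * partial r (H r i m n) z)" for r
    using foldr_partial_triple_sum[of "[r]" "H r" z c, OF H1] by (simp add: K_def[abs_def])
  then have "(\<Sum>r\<in>UNIV. partial r (K r) z)
      = (\<Sum>i\<in>UNIV. \<Sum>m\<in>UNIV. \<Sum>n\<in>UNIV. c i m n * (\<Sum>r\<in>UNIV. partial r (H r i m n) z))"
    using sum4_rotate[of "\<lambda>r i m n. c i m n * partial r (H r i m n) z"] by (simp add: sum_distrib_left)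
  also have "\<dots> = - 2 * (\<Sum>i\<in>UNIV. \<Sum>m\<in>UNIV. \<Sum>n\<in>UNIV. c i m n * I_term i m n z)
      + (\<Sum>i\<in>UNIV. \<Sum>m\<in>UNIV. \<Sum>n\<in>UNIV. if m = i then c i m n * z $ n else 0)
      + (\<Sum>i\<in>UNIV. \<Sum>m\<in>UNIV. \<Sum>n\<in>UNIV. c i m n * (inv_metric f z $ m $ n * partial i f z))"
  proof -
    have "c i m n * (\<Sum>r\<in>UNIV. partial r (H r i m n) z) = - 2 * (c i m n * I_term i m n z)
        + (if m = i then c i m n * z $ n else 0) + c i m n * (inv_metric f z $ m $ n * partial i f z)" for i m n
      by (simp add: partial_H_trace[OF z] I_term_def algebra_simps)
    then show ?thesis
      by (simp only: sum.distrib sum_distrib_left)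
  qed
  also have "(\<Sum>i\<in>UNIV. \<Sum>m\<in>UNIV. \<Sum>n\<in>UNIV. if m = i then c i m n * z $ n else 0)
      = (\<Sum>n\<in>UNIV. (\<Sum>i\<in>UNIV. c i i n) * z $ n)"
  proof -
    have "(\<Sum>m\<in>UNIV. \<Sum>n\<in>UNIV. if m = i then c i m n * z $ n else 0) = (\<Sum>n\<in>UNIV. c i i n * z $ n)" for i
      by (subst sum.swap) simp
    then show ?thesis
      unfolding sum_distrib_right by (simp add: sum.swap[of "\<lambda>n i. c i i n * z $ n"])
  qed
  also have "(\<Sum>i\<in>UNIV. \<Sum>m\<in>UNIV. \<Sum>n\<in>UNIV. c i m n * (inv_metric f z $ m $ n * partial i f z)) = 0"
  proof (rule sum.neutral, rule ballI)
    fix i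
    show "(\<Sum>m\<in>UNIV. \<Sum>n\<in>UNIV. c i m n * (inv_metric f z $ m $ n * partial i f z)) = 0" (is "?X = 0")
    proof -
      have "c i m n * (inv_metric f z $ m $ n * partial i f z) = - (c i n m * (inv_metric f z $ n $ m * partial i f z))" for m n
        using c_antisym[of i m n] inv_metric_sym[OF z, of m n] by simp
      then have "?X = (\<Sum>m\<in>UNIV. \<Sum>n\<in>UNIV. - (c i n m * (inv_metric f z $ n $ m * partial i f z)))"
        by (rule sum.cong[OF refl sum.cong[OF refl]])
      also have "\<dots> = - ?X"
        unfolding sum_negf by (subst sum.swap) (rule refl)
      finally show ?thesis
        by simp
    qed
  qed
  finally show ?thesis
    by simp
qed

text \<open>The mean Cartan tensor contains third derivatives, so two derivatives of
  \<open>I_term\<close> again use level 5 of \<open>f\<close>.\<close>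

lemma kdiff_I_term:
  assumes "kdiff (Suc (Suc (Suc k))) f w" "w \<in> R"
  shows "kdiff k (I_term i m n) w"
proof -
  have g: "kdiff k (\<lambda>z. inv_metric f z $ a $ b) w" for a b
    using kdiff_SucD[OF kdiff_inv_metric[OF assms]] .
  have "kdiff k (partial i f) w"
    using assms(1) kdiff_SucD kdiff_partial by blast
  moreover have "kdiff k (partial a (partial b (partial d f))) w" for a b d
    using assms(1) by simp
  ultimately show ?thesis
    unfolding I_term_def[abs_def] mean_cartan_def mean_cartan_low_def cartan_def
    by (intro kdiff_mult kdiff_sum kdiff_const kdiff_component finite g)
qed

lemma trace_eq:
  assumes w: "w \<in> R" and f5: "kdiff 5 f w"
  shows "(\<Sum>r\<in>UNIV. partial r (partial b (partial d (K r))) w)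
    = - 2 * (\<Sum>i\<in>UNIV. \<Sum>m\<in>UNIV. \<Sum>n\<in>UNIV. c i m n * partial b (partial d (I_term i m n)) w)"
proof -
  have "(5::nat) = Suc (Suc (Suc (Suc (Suc 0))))"
    by simp
  then have f': "kdiff (Suc (Suc (Suc (Suc (Suc 0))))) f w"
    using f5 by (simp only:)
  have K3: "kdiff (Suc (Suc (Suc 0))) (K r) w" for r
    using f' w by (rule kdiff_K)
  have I2: "kdiff (length [b, d]) (I_term i m n) w" for i m n
    using kdiff_I_term[OF f' w] by simp
  have "partial r (partial b (partial d (K r))) w = foldr partial [b, d] (partial r (K r)) w" for r
  proof -
    \<comment> \<open>This swap is used at \<open>w\<close> only. The next one lies under
      \<open>partial b\<close> and must hold on a neighbourhood, which the level 3 of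
      \<open>K r\<close> allows.\<close>
    have "partial r (partial b (partial d (K r))) w = partial b (partial r (partial d (K r))) w"
      by (rule partial_commute[OF kdiff_partial[OF K3]])
    moreover have "\<forall>\<^sub>F z in nhds w. partial r (partial d (K r)) z = partial d (partial r (K r)) z"
      using kdiff_eventually[OF K3] by eventually_elim (rule partial_commute)
    ultimately show ?thesis
      using partial_cong by auto
  qed
  then have "(\<Sum>r\<in>UNIV. partial r (partial b (partial d (K r))) w)
      = foldr partial [b, d] (\<lambda>z. \<Sum>r\<in>UNIV. partial r (K r) z) w"
    using foldr_partial_sum[of UNIV "[b, d]" "\<lambda>r. partial r (K r)"] kdiff_partial[OF K3] by simp
  also have "\<dots> = foldr partial [b, d] (\<lambda>z. - 2 * (\<Sum>i\<in>UNIV. \<Sum>m\<in>UNIV. \<Sum>n\<in>UNIV. c i m n * I_term i m n z)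
    + (\<Sum>n\<in>UNIV. (\<Sum>i\<in>UNIV. c i i n) * z $ n)) w"
    using eventually_in_R[OF w] by (intro foldr_partial_cong, eventually_elim) (rule partial_K_trace)
  also have "\<dots> = - 2 * foldr partial [b, d] (\<lambda>z. \<Sum>i\<in>UNIV. \<Sum>m\<in>UNIV. \<Sum>n\<in>UNIV. c i m n * I_term i m n z) w
    + foldr partial [b, d] (\<lambda>z. \<Sum>n\<in>UNIV. (\<Sum>i\<in>UNIV. c i i n) * z $ n) w"
    by (subst foldr_partial_add, intro kdiff_mult kdiff_const kdiff_sum I2 finite,
        intro kdiff_mult kdiff_const kdiff_sum kdiff_component finite,
        subst foldr_partial_cmult, intro kdiff_mult kdiff_const kdiff_sum I2 finite, rule refl)
  also have "foldr partial [b, d] (\<lambda>z. \<Sum>n\<in>UNIV. (\<Sum>i\<in>UNIV. c i i n) * z $ n) w = 0"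
    using foldr_partial_sum_cmult[of "[b, d]" "\<lambda>n z. z $ n" w "\<lambda>n. \<Sum>i\<in>UNIV. c i i n", OF kdiff_component]
    by (simp add: partial_partial_component)
  also have "foldr partial [b, d] (\<lambda>z. \<Sum>i\<in>UNIV. \<Sum>m\<in>UNIV. \<Sum>n\<in>UNIV. c i m n * I_term i m n z) w
    = (\<Sum>i\<in>UNIV. \<Sum>m\<in>UNIV. \<Sum>n\<in>UNIV. c i m n * partial b (partial d (I_term i m n)) w)"
    using foldr_partial_triple_sum[OF I2] by simp
  finally show ?thesis
    by simp
qed

end

section \<open>The curvature formulas in the moving frame\<close>

context moving_frame
begin

theorem berwald_frame_formula:
  assumes y: "B x *v y \<in> R" and f5: "kdiff 5 f (B x *v y)"
    and e: "\<And>a \<mu>. e a x $ \<mu> = E $ \<mu> $ a" and dual: "dual_vierbein e x = B x"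
  shows "2 * berwald_frame F e x y r a b d = (\<Sum>i\<in>UNIV. \<Sum>m\<in>UNIV. \<Sum>n\<in>UNIV. c i m n *
    partial a (partial b (partial d (H r i m n))) (B x *v y))"
proof -
  have "(5::nat) = Suc (Suc (length [a, b, d]))"
    by simp
  then have "kdiff (length [a, b, d]) (H r i m n) (B x *v y)" for i m n
    using f5 y by (intro kdiff_H) (simp_all only:)
  from foldr_partial_triple_sum[of "[a, b, d]" "H r", OF this] show ?thesis
    by (simp add: berwald_frame_eq[OF assms] K_def[abs_def])
qed

theorem berwald_trace_formula:
  assumes y: "B x *v y \<in> R" and f5: "kdiff 5 f (B x *v y)"
    and e: "\<And>a \<mu>. e a x $ \<mu> = E $ \<mu> $ a" and dual: "dual_vierbein e x = B x"
  shows "(\<Sum>r\<in>UNIV. berwald_frame F e x y r r b d) = - (\<Sum>i\<in>UNIV. \<Sum>m\<in>UNIV. \<Sum>n\<in>UNIV. c i m n *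
    partial b (partial d (I_term i m n)) (B x *v y))"
proof -
  have "2 * (\<Sum>r\<in>UNIV. berwald_frame F e x y r r b d)
      = (\<Sum>r\<in>UNIV. partial r (partial b (partial d (K r))) (B x *v y))"
    by (simp add: sum_distrib_left berwald_frame_eq[OF assms])
  then show ?thesis
    by (simp add: trace_eq[OF y f5])
qed

text \<open>The bracket differentiates the frame fields, so \<open>e\<close> has to agree with the
  inverse of \<open>B\<close> around \<open>x\<close>, not merely at \<open>x\<close>.\<close>

lemma c_eq_commutation_coeffs:
  assumes e: "\<And>a. \<forall>\<^sub>F z in nhds x. e a z = (\<chi> \<mu>. matrix_inv (B z) $ \<mu> $ a)"
    and C: "lie_bracket (e m) (e n) x = (\<Sum>k\<in>UNIV. C k *\<^sub>R e k x)"
  shows "C k = c k m n"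
proof (rule commutation_coeff_unique[where k = C and l = "\<lambda>k. c k m n"])
  fix \<mu>
  have ex: "e a x = (\<chi> \<mu>. E $ \<mu> $ a)" for a
    using eventually_nhds_x_imp_x[OF e] by (simp add: E_def)
  have "partial \<nu> (\<lambda>z. e a z $ \<mu>) x = partial \<nu> (\<lambda>z. matrix_inv (B z) $ \<mu> $ a) x" for \<nu> \<mu> a
    by (rule partial_cong) (use e[of a] in \<open>eventually_elim, simp\<close>)
  then have "lie_bracket (e m) (e n) x
      = lie_bracket (\<lambda>z. \<chi> \<mu>. matrix_inv (B z) $ \<mu> $ m) (\<lambda>z. \<chi> \<mu>. matrix_inv (B z) $ \<mu> $ n) x"
    by (simp add: lie_bracket_def ex E_def)
  with C lie_bracket_frame[of m n \<mu>] show "(\<Sum>a\<in>UNIV. E $ \<mu> $ a * C a) = (\<Sum>a\<in>UNIV. E $ \<mu> $ a * c a m n)"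
    by (simp add: ex mult.commute)
qed

end

section \<open>Bases and the nondegenerate Hessian\<close>

lemma is_basis_sum_eq_0:
  fixes w :: "real^'n"
  assumes b: "is_basis b" and "(\<Sum>a\<in>UNIV. w $ a *\<^sub>R b a) = 0"
  shows "w = 0"
proof -
  have inj: "inj b" and ind: "independent (range b)"
    using b by (auto simp: is_basis_def)
  have "(\<Sum>v\<in>range b. w $ (the_inv b v) *\<^sub>R v) = 0"
    using assms(2) inj by (simp add: sum.reindex the_inv_f_f)
  then have "w $ (the_inv b (b a)) = 0" for a
    using independentD[OF ind, of "range b" "\<lambda>v. w $ (the_inv b v)"] by simp
  then show ?thesis
    using inj by (simp add: the_inv_f_f vec_eq_iff)
qed

lemma is_basis_representation:
  fixes b :: "'n::finite \<Rightarrow> 'v::euclidean_space"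
  assumes b: "is_basis b"
  obtains w :: "real^'n" where "v = (\<Sum>a\<in>UNIV. w $ a *\<^sub>R b a)"
proof -
  have "v \<in> span (range b)"
    using b by (simp add: is_basis_def)
  then obtain u where "v = (\<Sum>v\<in>range b. u v *\<^sub>R v)"
    by (auto simp: span_finite)
  also have "\<dots> = (\<Sum>a\<in>UNIV. u (b a) *\<^sub>R b a)"
    using b by (simp add: is_basis_def sum.reindex)
  finally show ?thesis
    using that[of "\<chi> a. u (b a)"] by simp
qed

lemma matrix_nonsingularI:
  fixes M :: "real^'n^'n"
  assumes "\<And>v. M *v v = 0 \<Longrightarrow> v = 0"
  shows "det M \<noteq> 0"
proof -
  obtain N where "N ** M = mat 1"
    using assms matrix_left_invertible_ker[of M] by blast
  then have "det N * det M = 1"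
    by (metis det_I det_mul)
  then show ?thesis
    by auto
qed

lemma hessian_combination_left:
  assumes "C_on 2 L \<omega>" "z \<in> \<omega>"
  shows "hessian L z (\<Sum>a\<in>UNIV. w $ a *\<^sub>R b a) v = (\<Sum>a\<in>UNIV. w $ a * hessian L z (b a) v)"
proof -
  have "(\<lambda>z. frechet_derivative L (at z) v) differentiable (at z)"
    using assms by (simp add: numeral_2_eq_2)
  then have "linear (frechet_derivative (\<lambda>z. frechet_derivative L (at z) v) (at z))"
    using frechet_derivative_works has_derivative_linear by blast
  then show ?thesis
    by (simp add: hessian_def linear_sum linear_cmul)
qed

text \<open>The right slot sits inside the outer derivative: linearity of the inner derivative holds
  at each point of \<open>\<omega>\<close>, and openness lets that identity be
  differentiated.\<close>

lemma hessian_combination_right: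
  fixes L :: "'v::euclidean_space \<Rightarrow> real"
  assumes "open \<omega>" "C_on 2 L \<omega>" "z \<in> \<omega>"
  shows "hessian L z u (\<Sum>a\<in>UNIV. w $ a *\<^sub>R b a) = (\<Sum>a\<in>UNIV. w $ a * hessian L z u (b a))"
proof -
  let ?DL = "\<lambda>v z. frechet_derivative L (at z) v" and ?v = "\<Sum>a\<in>UNIV. w $ a *\<^sub>R b a"
  have d: "(?DL v has_derivative frechet_derivative (?DL v) (at z)) (at z)" for v
    using assms(2,3) by (simp add: numeral_2_eq_2 frechet_derivative_works[symmetric])
  have lin: "(\<Sum>a\<in>UNIV. w $ a * ?DL (b a) y) = ?DL ?v y" if "y \<in> \<omega>" for y
  proof -
    have "L differentiable (at y)"
      using assms(2) that by (simp add: numeral_2_eq_2)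
    then have "linear (frechet_derivative L (at y))"
      using frechet_derivative_works has_derivative_linear by blast
    then show ?thesis
      by (simp add: linear_sum linear_cmul)
  qed
  have "\<forall>\<^sub>F y in at z. y \<in> \<omega>"
    using assms(1,3) eventually_at_topological by blast
  then have ev: "\<forall>\<^sub>F y in at z. (\<Sum>a\<in>UNIV. w $ a * ?DL (b a) y) = ?DL ?v y"
    by eventually_elim (rule lin)
  have der: "((\<lambda>y. \<Sum>a\<in>UNIV. w $ a * ?DL (b a) y) has_derivative
      (\<lambda>u. \<Sum>a\<in>UNIV. w $ a * frechet_derivative (?DL (b a)) (at z) u)) (at z)"
    by (intro has_derivative_sum has_derivative_mult_right d)
  have "(?DL ?v has_derivative (\<lambda>u. \<Sum>a\<in>UNIV. w $ a * frechet_derivative (?DL (b a)) (at z) u)) (at z)"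
    by (rule has_derivative_transform_eventually[OF der ev lin[OF assms(3)]]) simp
  from has_derivative_unique[OF d this] show ?thesis
    by (simp add: hessian_def fun_eq_iff)
qed

text \<open>A kernel vector of the component matrix yields a vector annihilated by the Hessian. The
  matrix acts on the second slot while non-degeneracy is stated for the first, so symmetry of the
  metric is used in between.\<close>

lemma det_metric_in_basis:
  assumes M: "pseudo_minkowski \<omega> L" and b: "is_basis b" and y: "y \<in> basis_region b \<omega>"
  shows "det (metric (in_basis b L) y) \<noteq> 0"
proof (rule matrix_nonsingularI)
  let ?Y = "\<Sum>a\<in>UNIV. y $ a *\<^sub>R b a"
  have op: "open \<omega>" and C4: "C_on 4 L \<omega>"
    using M by (simp_all add: pseudo_minkowski_def open_cone_def)
  have "(4::nat) = Suc (Suc 2)"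
    by simp
  then have C2: "C_on 2 L \<omega>"
    using C4 C_on_SucD by metis
  have Y: "?Y \<in> \<omega>"
    using y by (simp add: basis_region_def)
  have "kdiff (Suc (Suc 0)) (in_basis b L) y"
    using kdiff_in_basis[OF op C2 y] by (simp only: numeral_2_eq_2)
  note sym = metric_symmetric[OF this]
  fix v
  assume "metric (in_basis b L) y *v v = 0"
  then have ker: "(\<Sum>j\<in>UNIV. metric (in_basis b L) y $ i $ j * v $ j) = 0" for i
    by (simp add: matrix_vector_mult_def vec_eq_iff)
  have vh: "v $ j * hessian L ?Y (b j) (b i) = metric (in_basis b L) y $ i $ j * v $ j" for i j
    using sym[of i j] by (simp add: metric_in_basis[OF op C2 y])
  have "(\<Sum>j\<in>UNIV. v $ j * hessian L ?Y (b j) (b i)) = 0" for i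
    unfolding vh by (rule ker)
  then have *: "hessian L ?Y (\<Sum>j\<in>UNIV. v $ j *\<^sub>R b j) (b i) = 0" for i
    by (simp add: hessian_combination_left[OF C2 Y])
  have "hessian L ?Y (\<Sum>j\<in>UNIV. v $ j *\<^sub>R b j) u = 0" for u
  proof -
    obtain t where "u = (\<Sum>a\<in>UNIV. t $ a *\<^sub>R b a)"
      using is_basis_representation[OF b] .
    then show ?thesis
      by (simp add: hessian_combination_right[OF op C2 Y] *)
  qed
  then have "(\<Sum>j\<in>UNIV. v $ j *\<^sub>R b j) = 0"
    using M Y unfolding pseudo_minkowski_def by blast
  then show "v = 0"
    by (rule is_basis_sum_eq_0[OF b])
qed

section \<open>Tangent vectors and the vierbein\<close>

lemma chart_pt_inverse:
  assumes "manifold_atlas A" "ch \<in> A" "p \<in> fst ch"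
  shows "chart_pt ch (snd ch p) = p"
  using assms unfolding manifold_atlas_def homeomorphism_def by blast

lemma open_chart_image:
  assumes "manifold_atlas A" "ch \<in> A" "open U"
  shows "open (snd ch ` (U \<inter> fst ch))"
proof -
  have h: "homeomorphism (fst ch) (snd ch ` fst ch) (snd ch) (chart_pt ch)" and "open (snd ch ` fst ch)"
    using assms by (auto simp: manifold_atlas_def)
  moreover have "openin (top_of_set (fst ch)) (U \<inter> fst ch)"
    using assms(3) by (metis Int_commute openin_open_Int)
  ultimately show ?thesis
    using homeomorphism_imp_open_map[OF h] openin_open_trans by blast
qed

lemma transition_derivative_linear:
  assumes "manifold_atlas A" "ch \<in> A" "ch' \<in> A" "p \<in> fst ch" "p \<in> fst ch'"
  shows "linear (frechet_derivative (transition ch ch') (at (snd ch p)))"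
proof -
  have "C_on 3 (transition ch ch') (snd ch ` (fst ch \<inter> fst ch'))"
    using assms unfolding manifold_atlas_def by blast
  then have "transition ch ch' differentiable (at (snd ch p))"
    using assms(4,5) by (simp add: numeral_3_eq_3)
  then show ?thesis
    using frechet_derivative_works has_derivative_linear by blast
qed

lemma tangent_space_combination:
  assumes "manifold_atlas A" "u \<in> tangent_space A p" "v \<in> tangent_space A p"
  shows "(\<lambda>ch. s *\<^sub>R u ch + t *\<^sub>R v ch) \<in> tangent_space A p"
proof -
  have transform: "s *\<^sub>R u ch' + t *\<^sub>R v ch'
      = frechet_derivative (transition ch ch') (at (snd ch p)) (s *\<^sub>R u ch + t *\<^sub>R v ch)"
    if c: "ch \<in> A" "ch' \<in> A" "p \<in> fst ch" "p \<in> fst ch'" for ch ch'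
  proof -
    have "u ch' = frechet_derivative (transition ch ch') (at (snd ch p)) (u ch)"
         "v ch' = frechet_derivative (transition ch ch') (at (snd ch p)) (v ch)"
      using assms(2,3) c unfolding tangent_space_def by blast+
    then show ?thesis
      using transition_derivative_linear[OF assms(1) c] by (simp add: linear_add linear_cmul)
  qed
  have zero: "u ch = 0" "v ch = 0" if "\<not> (ch \<in> A \<and> p \<in> fst ch)" for ch
    using assms(2,3) that unfolding tangent_space_def by blast+
  show ?thesis
    unfolding tangent_space_def
  proof (intro CollectI conjI allI ballI impI)
    show "s *\<^sub>R u ch + t *\<^sub>R v ch = 0" if "\<not> (ch \<in> A \<and> p \<in> fst ch)" for ch
      using zero[OF that] by simp
  qed (rule transform, blast+)
qed

lemma tangent_space_eqI:
  assumes "ch \<in> A" "p \<in> fst ch" "u \<in> tangent_space A p" "v \<in> tangent_space A p" "u ch = v ch"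
  shows "u = v"
proof
  fix ch'
  show "u ch' = v ch'"
  proof (cases "ch' \<in> A \<and> p \<in> fst ch'")
    case True
    then have "u ch' = frechet_derivative (transition ch ch') (at (snd ch p)) (u ch)"
         "v ch' = frechet_derivative (transition ch ch') (at (snd ch p)) (v ch)"
      using assms(1-4) unfolding tangent_space_def by blast+
    then show ?thesis
      using assms(5) by simp
  next
    case False
    then have "u ch' = 0" "v ch' = 0"
      using assms(3,4) unfolding tangent_space_def by blast+
    then show ?thesis
      by simp
  qed
qed

text \<open>One chart determines a tangent vector, and \<open>v\<close> itself witnesses existence,
  so the definite description denotes \<open>v\<close>.\<close>

lemma tangent_of_eq:
  assumes "ch \<in> A" "p \<in> fst ch" "v \<in> tangent_space A p"
  shows "tangent_of A ch p (v ch) = v"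
  unfolding tangent_of_def
proof (rule the_equality)
  show "u = v" if "u \<in> tangent_space A p \<and> u ch = v ch" for u
    using tangent_space_eqI[OF assms(1,2)] assms(3) that by blast
qed (simp add: assms(3))

section \<open>The vierbein of a local model in one chart\<close>

locale vierbein_chart =
  fixes A :: "('m::{t2_space, second_countable_topology}, 'n::finite) chart set"
    and \<Omega> :: "'m \<Rightarrow> ('m, 'n) tvec set"
    and \<L> :: "'m \<Rightarrow> ('m, 'n) tvec \<Rightarrow> real"
    and \<omega> :: "'v::euclidean_space set"
    and L :: "'v \<Rightarrow> real"
    and b :: "'n \<Rightarrow> 'v"
    and U :: "'m set"
    and \<phi> :: "'m \<Rightarrow> ('m, 'n) tvec \<Rightarrow> 'v"
    and ch :: "('m, 'n) chart"
  assumes minkowski: "pseudo_minkowski \<omega> L"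
    and finsler: "pseudo_finsler A \<Omega> \<L>"
    and basis: "is_basis b"
    and model: "local_model A \<Omega> \<L> \<omega> L U \<phi>"
    and chart: "ch \<in> A"
begin

abbreviation "S \<equiv> snd ch ` (U \<inter> fst ch)"
abbreviation "T w \<equiv> \<Sum>a\<in>UNIV. w $ a *\<^sub>R b a"
abbreviation "e \<equiv> vierbein A ch \<phi> b"
abbreviation "frame z \<equiv> \<chi> \<mu> a. e a z $ \<mu>"

lemma atlas: "manifold_atlas A"
  using finsler by (simp add: pseudo_finsler_def)

lemma chart_pt_in: "z \<in> S \<Longrightarrow> chart_pt ch z \<in> U" "z \<in> S \<Longrightarrow> chart_pt ch z \<in> fst ch"
  using chart_pt_inverse[OF atlas chart] by auto

lemma open_S: "open S"
  using open_chart_image[OF atlas chart] model by (simp add: local_model_def)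

lemma \<Omega>_subset: "\<Omega> p \<subseteq> tangent_space A p"
  using finsler by (simp add: pseudo_finsler_def)

lemma \<phi>_image: "p \<in> U \<Longrightarrow> \<phi> p ` \<Omega> p = \<omega>"
  using model unfolding local_model_def by blast

lemma L_\<phi>:
  assumes "p \<in> U" "v \<in> \<Omega> p"
  shows "L (\<phi> p v) = \<L> p v"
proof -
  have "\<forall>v\<in>closure (\<Omega> p). L (\<phi> p v) = \<L> p v"
    using model assms(1) unfolding local_model_def by blast
  then show ?thesis
    using assms(2) closure_subset by blast
qed

lemma \<phi>_differentiable:
  assumes "z \<in> S"
  shows "(\<lambda>z. \<phi> (chart_pt ch z) (tangent_of A ch (chart_pt ch z) y)) differentiable (at z)"
proof -
  have "C_on (Suc 0) (\<lambda>z. \<phi> (chart_pt ch z) (tangent_of A ch (chart_pt ch z) y)) S"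
    using model chart unfolding local_model_def One_nat_def by blast
  then show ?thesis
    using assms unfolding C_on.simps by blast
qed

context
  fixes z p
  assumes z: "z \<in> S"
  defines p: "p \<equiv> chart_pt ch z"
begin

definition "\<psi> = inv_into (tangent_space A p) (\<phi> p)"

lemma p_in: "p \<in> U" "p \<in> fst ch"
  using chart_pt_in[OF z] by (simp_all add: p)

lemma \<phi>_bij: "bij_betw (\<phi> p) (tangent_space A p) UNIV"
  using model p_in(1) by (simp add: local_model_def)

lemma \<psi>_in: "\<psi> v \<in> tangent_space A p"
  using \<phi>_bij unfolding \<psi>_def bij_betw_def by (metis UNIV_I inv_into_into)

lemma \<phi>_\<psi>: "\<phi> p (\<psi> v) = v"
  using \<phi>_bij unfolding \<psi>_def bij_betw_def by (metis UNIV_I f_inv_into_f)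

lemma \<psi>_eqI: "u \<in> tangent_space A p \<Longrightarrow> \<phi> p u = v \<Longrightarrow> \<psi> v = u"
  using \<phi>_bij unfolding \<psi>_def bij_betw_def by (metis inv_into_f_f)

text \<open>The inverse of a linear bijection, evaluated at \<open>ch\<close> because tangent
  vectors are mere functions on charts while their components form a vector space.\<close>

lemma \<psi>_linear: "linear (\<lambda>v. \<psi> v ch)"
proof -
  have comb: "\<psi> (s *\<^sub>R u + t *\<^sub>R v) ch = s *\<^sub>R \<psi> u ch + t *\<^sub>R \<psi> v ch" for s t u v
  proof -
    have "\<phi> p (\<lambda>ch. s *\<^sub>R \<psi> u ch + t *\<^sub>R \<psi> v ch) = s *\<^sub>R u + t *\<^sub>R v"
      using model p_in(1) \<psi>_in by (simp add: local_model_def \<phi>_\<psi>)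
    then have "\<psi> (s *\<^sub>R u + t *\<^sub>R v) = (\<lambda>ch. s *\<^sub>R \<psi> u ch + t *\<^sub>R \<psi> v ch)"
      by (intro \<psi>_eqI tangent_space_combination atlas \<psi>_in)
    then show ?thesis
      by simp
  qed
  show ?thesis
    using comb[of 1 _ 1] comb[of _ _ 0] by (intro linearI) simp_all
qed

text \<open>The vierbein matrix is the matrix of the inverse of \<open>\<phi> p\<close>, from the
  basis \<open>b\<close> to the coordinates of \<open>ch\<close>.\<close>

lemma frame_apply: "frame z *v w = \<psi> (T w) ch"
proof -
  have "e a z = \<psi> (b a) ch" for a
    by (simp add: vierbein_def \<psi>_def p)
  then show ?thesis
    by (simp add: linear_sum[OF \<psi>_linear] linear_cmul[OF \<psi>_linear] vec_eq_iff matrix_vector_mult_def mult.commute)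
qed

text \<open>\<open>v \<mapsto> v ch\<close> is injective on the tangent space, which \<open>\<psi>\<close> parametrises by \<open>'v\<close>: a square
  system, so the vierbein is invertible without any appeal to the cocycle condition.\<close>

lemma det_frame: "det (frame z) \<noteq> 0"
proof (rule matrix_nonsingularI)
  fix w
  assume "frame z *v w = 0"
  then have "\<psi> (T w) ch = \<psi> 0 ch"
    by (simp add: frame_apply linear_0[OF \<psi>_linear])
  then have "\<psi> (T w) = \<psi> 0"
    using tangent_space_eqI[OF chart p_in(2) \<psi>_in \<psi>_in] by blast
  then have "T w = 0"
    using \<phi>_\<psi> by metis
  then show "w = 0"
    by (rule is_basis_sum_eq_0[OF basis])
qed

lemma dual_frame: "frame z ** dual_vierbein e z = mat 1" "dual_vierbein e z ** frame z = mat 1"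
  unfolding dual_vierbein_def using matrix_inv[OF det_frame] by simp_all

lemma det_dual_vierbein: "det (dual_vierbein e z) \<noteq> 0"
  using dual_frame(1) by (metis det_I det_mul mult_zero_right zero_neq_one)

lemma matrix_inv_dual_vierbein: "matrix_inv (dual_vierbein e z) = frame z"
  using dual_frame(1) by (rule matrix_inv_unique)

text \<open>Invertibility of the frame shows that every \<open>y\<close> is the component vector of
  some tangent vector, so \<open>tangent_of\<close> is meaningful for all \<open>y\<close>.\<close>

lemma tangent_of_frame: "tangent_of A ch p y = \<psi> (T (dual_vierbein e z *v y))"
proof -
  have "y = frame z *v (dual_vierbein e z *v y)"
    by (simp add: matrix_vector_mul_assoc dual_frame)
  then have "y = \<psi> (T (dual_vierbein e z *v y)) ch"
    by (simp add: frame_apply)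
  then show ?thesis
    using tangent_of_eq[OF chart p_in(2) \<psi>_in] by metis
qed

lemma \<phi>_tangent_of: "\<phi> p (tangent_of A ch p y) = T (dual_vierbein e z *v y)"
  by (simp add: tangent_of_frame \<phi>_\<psi>)

text \<open>\<open>\<phi> p\<close> maps \<open>\<Omega> p\<close> onto \<open>\<omega>\<close>,
  which supplies a fibre vector; injectivity identifies it with \<open>tangent_of A ch p y\<close>,
  and the model identity for the Lagrangians applies.\<close>

lemma coord_lagrangian_frame:
  assumes "dual_vierbein e z *v y \<in> basis_region b \<omega>"
  shows "coord_lagrangian A \<L> ch z y = in_basis b L (dual_vierbein e z *v y)"
proof -
  have "T (dual_vierbein e z *v y) \<in> \<phi> p ` \<Omega> p"
    using assms \<phi>_image p_in(1) by (simp add: basis_region_def)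
  then obtain v where v: "v \<in> \<Omega> p" "\<phi> p v = T (dual_vierbein e z *v y)"
    by auto
  then have "tangent_of A ch p y = v"
    using \<psi>_eqI \<Omega>_subset tangent_of_frame by blast
  with L_\<phi>[OF p_in(1) v(1)] show ?thesis
    by (simp add: coord_lagrangian_def in_basis_def p[symmetric] v(2))
qed

lemma fibre_cone_frame:
  assumes "y \<in> fibre_cone \<Omega> ch p"
  shows "dual_vierbein e z *v y \<in> basis_region b \<omega>"
proof -
  obtain v where v: "v \<in> \<Omega> p" "y = v ch"
    using assms by (auto simp: fibre_cone_def)
  then have "tangent_of A ch p y = v"
    using tangent_of_eq[OF chart p_in(2)] \<Omega>_subset by blast
  then have "T (dual_vierbein e z *v y) = \<phi> p v"
    using \<phi>_tangent_of[of y] by simp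
  also have "\<dots> \<in> \<omega>"
    using \<phi>_image[OF p_in(1)] v(1) by blast
  finally show ?thesis
    by (simp add: basis_region_def)
qed

end

lemma dual_vierbein_differentiable:
  assumes z: "z \<in> S"
  shows "(\<lambda>z. dual_vierbein e z $ a $ \<mu>) differentiable (at z)"
proof -
  have lin: "linear (\<lambda>w::real^'n. T w)"
    by (intro linearI) (simp_all add: scaleR_add_left sum.distrib scaleR_sum_right)
  have "inj (\<lambda>w::real^'n. T w)"
    using is_basis_sum_eq_0[OF basis] by (simp add: linear_injective_0[OF lin])
  \<comment> \<open>\<open>g\<close> reads off components in the basis \<open>b\<close>; applied to
    \<phi>(\<partial>_\<mu>) it returns the column e^a_\<mu> of the dual vierbein.\<close>
  then obtain g where g: "linear g" "g \<circ> (\<lambda>w::real^'n. T w) = id"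
    using linear_injective_left_inverse[OF lin] by blast
  have gT: "g (T w) = w" for w :: "real^'n"
    using g(2) by (simp add: fun_eq_iff)
  let ?\<Phi> = "\<lambda>z. \<phi> (chart_pt ch z) (tangent_of A ch (chart_pt ch z) (axis \<mu> 1))"
  have "?\<Phi> differentiable (at z)"
    using z by (rule \<phi>_differentiable)
  then have "(\<lambda>z. g (?\<Phi> z)) differentiable (at z)"
    by (rule differentiable_compose[rotated]) (rule linear_imp_differentiable[OF g(1)])
  then have "(\<lambda>z. g (?\<Phi> z) $ a) differentiable (at z)"
    by (rule differentiable_compose[rotated]) simp
  moreover have "\<forall>\<^sub>F z in nhds z. z \<in> S"
    using open_S z eventually_nhds by blast
  then have "\<forall>\<^sub>F z in nhds z. g (?\<Phi> z) $ a = dual_vierbein e z $ a $ \<mu>"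
    by eventually_elim (simp only: \<phi>_tangent_of gT, simp add: matrix_vector_mult_basis column_def)
  ultimately show ?thesis
    by (rule differentiable_cong_nhds[rotated])
qed

lemma moving_frame:
  assumes "x \<in> S"
  shows "moving_frame (dual_vierbein e) (in_basis b L) (coord_lagrangian A \<L> ch) S (basis_region b \<omega>) x"
proof
  show "open (basis_region b \<omega>)"
    using minkowski by (simp add: open_basis_region pseudo_minkowski_def open_cone_def)
  show "kdiff 4 (in_basis b L) w" if "w \<in> basis_region b \<omega>" for w
    using minkowski that by (intro kdiff_in_basis) (simp_all add: pseudo_minkowski_def open_cone_def)
qed (use assms in \<open>simp_all add: open_S dual_vierbein_differentiable det_dual_vierbein
      coord_lagrangian_frame det_metric_in_basis[OF minkowski basis]\<close>)

end

theorem mainTheorem4: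
  fixes A :: "('m::{t2_space, second_countable_topology}, 'n::finite) chart set"
    and \<Omega> :: "'m \<Rightarrow> ('m, 'n) tvec set"
    and \<L> :: "'m \<Rightarrow> ('m, 'n) tvec \<Rightarrow> real"
    and \<omega> :: "'v::euclidean_space set"
    and L :: "'v \<Rightarrow> real"
    and basis :: "'n \<Rightarrow> 'v"
    and U :: "'m set"
    and \<phi> :: "'m \<Rightarrow> ('m, 'n) tvec \<Rightarrow> 'v"
    and ch :: "('m, 'n) chart"
    and e :: "'n \<Rightarrow> real^'n \<Rightarrow> real^'n"
    and C :: "real^'n \<Rightarrow> 'n \<Rightarrow> 'n \<Rightarrow> 'n \<Rightarrow> real"
    and F :: "real^'n \<Rightarrow> real^'n \<Rightarrow> real"
    and f :: "real^'n \<Rightarrow> real"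
    and x y w :: "real^'n"
  assumes minkowski: "pseudo_minkowski \<omega> L"
    and finsler: "pseudo_finsler A \<Omega> \<L>"
    and modeled: "modeled_on A \<Omega> \<L> \<omega> L"
    and basis: "is_basis basis"
    and model: "local_model A \<Omega> \<L> \<omega> L U \<phi>"
    and chart: "ch \<in> A"
    and e: "e = vierbein A ch \<phi> basis"
    and C: "commutation_coeffs e (snd ch ` (U \<inter> fst ch)) C"
    and F: "F = coord_lagrangian A \<L> ch"
    and f: "f = in_basis basis L"
    and x: "x \<in> snd ch ` (U \<inter> fst ch)"
    and y: "y \<in> fibre_cone \<Omega> ch (chart_pt ch x)"
    and w: "w = dual_vierbein e x *v y"
    and fifth_derivatives: "\<And>i j k l.
          partial i (partial j (partial k (partial l f))) differentiable (at w)"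
  shows "(\<forall>r a b c.
           2 * berwald_frame F e x y r a b c =
             (\<Sum>i\<in>UNIV. \<Sum>m\<in>UNIV. \<Sum>n\<in>UNIV. C x i m n *
                partial a (partial b (partial c
                  (\<lambda>z. inv_metric f z $ r $ m * partial i f z * z $ n))) w)) \<and>
         (\<forall>b c.
           (\<Sum>r\<in>UNIV. berwald_frame F e x y r r b c) =
             - (\<Sum>i\<in>UNIV. \<Sum>m\<in>UNIV. \<Sum>n\<in>UNIV. C x i m n *
                partial b (partial c
                  (\<lambda>z. mean_cartan f m z * partial i f z * z $ n)) w)) \<and>
         (\<forall>b c.
           mean_berwald F e x y b c =
             - 1/2 * (\<Sum>i\<in>UNIV. \<Sum>m\<in>UNIV. \<Sum>n\<in>UNIV. C x i m n *
                partial b (partial c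
                  (\<lambda>z. mean_cartan f m z * partial i f z * z $ n)) w))"
proof -
  interpret V: vierbein_chart A \<Omega> \<L> \<omega> L basis U \<phi> ch
    by unfold_locales (fact minkowski finsler basis model chart)+
  interpret moving_frame "dual_vierbein e" f F "snd ch ` (U \<inter> fst ch)" "basis_region basis \<omega>" x
    unfolding e f F by (rule V.moving_frame[OF x])
  have wR: "dual_vierbein e x *v y \<in> basis_region basis \<omega>"
    using V.fibre_cone_frame[OF x y] by (simp add: e)
  \<comment> \<open>Level 4 holds on the open region around \<open>w\<close> because
    \<open>L\<close> is C^4; the fifth order is added at \<open>w\<close> alone.\<close>
  have "kdiff (Suc 4) f w"
  proof (rule kdiff_SucI)
    show "\<forall>\<^sub>F z in nhds w. kdiff 4 f z"
      using eventually_in_R[OF wR] f_kdiff by (auto simp: w elim: eventually_mono)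
    show "foldr partial is f differentiable (at w)" if "length is = 4" for "is"
    proof -
      have "length is = Suc (Suc (Suc (Suc 0)))"
        using that by simp
      then obtain i j k l where "is = [i, j, k, l]"
        unfolding length_Suc_conv by blast
      then show ?thesis
        using fifth_derivatives by simp
    qed
  qed
  moreover have "Suc 4 = 5"
    by simp
  ultimately have f5: "kdiff 5 f (dual_vierbein e x *v y)"
    by (simp only: w)
  have frame: "e a z = (\<chi> \<mu>. matrix_inv (dual_vierbein e z) $ \<mu> $ a)"
    if "z \<in> snd ch ` (U \<inter> fst ch)" for z a
    using V.matrix_inv_dual_vierbein[OF that] by (simp add: e vec_eq_iff)
  have ex: "e a x $ \<mu> = E $ \<mu> $ a" for a \<mu>
    using frame[OF x, of a] by (simp add: E_def)
  have "\<forall>\<^sub>F z in nhds x. z \<in> snd ch ` (U \<inter> fst ch)"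
    using open_S x eventually_nhds by blast
  then have "\<forall>\<^sub>F z in nhds x. e a z = (\<chi> \<mu>. matrix_inv (dual_vierbein e z) $ \<mu> $ a)" for a
    by eventually_elim (rule frame)
  moreover have "lie_bracket (e m) (e n) x = (\<Sum>k\<in>UNIV. C x k m n *\<^sub>R e k x)" for m n
    using C x unfolding commutation_coeffs_def by blast
  ultimately have Cc: "C x i m n = c i m n" for i m n
    by (rule c_eq_commutation_coeffs)
  show ?thesis
    using berwald_frame_formula[OF wR f5 ex refl] berwald_trace_formula[OF wR f5 ex refl]
    by (simp add: mean_berwald_def Cc w H_def[abs_def] I_term_def[abs_def])
qed

end
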